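(* Let $p>q$ be primes and let $A$ be a skew left brace of size $pq$, with associated semidirect product group $\Lambda_A=(A,\cdot)\rtimes_\lambda(A,\circ)$. Then $\Lambda_A$ is isomorphic to one of the following groups, where groups (2)–(4) are defined (and occur in the list) only when $p\equiv 1\pmod q$, in which case $g$ denotes a fixed element of $\mathbb{Z}_p$ of multiplicative order $q$: (1) $\mathbb{Z}_{pq}\times\mathbb{Z}_{pq}$; (2) $(\mathbb{Z}_p\times\mathbb{Z}_p)\rtimes_\theta(\mathbb{Z}_q\times\mathbb{Z}_q)$, where $\theta_{(x,y)}(a,b)=(g^y a,\,g^y b)$; (3) $(\mathbb{Z}_p\times\mathbb{Z}_p)\rtimes_\psi(\mathbb{Z}_q\times\mathbb{Z}_q)$, where $\psi_{(x,y)}(a,b)=(g^x a,\,g^y b)$; (4) $(\mathbb{Z}_p\times\mathbb{Z}_p)\rtimes_\xi(\mathbb{Z}_q\times\mathbb{Z}_q)$, where $\xi_{(x,y)}(a,b)=(g^x a+(1-g^x)b,\,b)$; for $x,y\in\mathbb{Z}_q$ and $a,b\in\mathbb{Z}_p$.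
   Context: A skew left brace is a set $A$ with two group structures $(A,\cdot)$ (additive group) and $(A,\circ)$ (multiplicative group) such that $a\circ(b\cdot c)=(a\circ b)\cdot a^{-1}\cdot(a\circ c)$ for all $a,b,c\in A$, where $a^{-1}$ is the inverse in $(A,\cdot)$. Its lambda map is the homomorphism $\lambda:(A,\circ)\to\operatorname{Aut}(A,\cdot)$, $\lambda_a(b)=a^{-1}\cdot(a\circ b)$. For a homomorphism $\psi:G\to\operatorname{Aut}(H)$, the group $H\rtimes_\psi G$ has operation $(h_1,g_1)(h_2,g_2)=(h_1\psi_{g_1}(h_2),g_1g_2)$. Put $\Lambda_A=(A,\cdot)\rtimes_\lambda(A,\circ)$. Known classification of skew left braces of order $pq$ (Acri–Bonatto), which may be used: if $p\not\equiv1\pmod q$, the only one up to isomorphism is the trivial one ($\circ=\cdot$) on the cyclic group $\mathbb{Z}_{pq}$. If $p\equiv1\pmod q$ and $g\in\mathbb{Z}_p$ has multiplicative order $q$, a complete list up to isomorphism is the following, on the set $\mathbb{Z}_p\times\mathbb{Z}_q$, the additive operation being written $+$. With $(n,m)+(s,t)=(n+s,m+t)$: $B$ (with $\circ=+$), and $C$ with $(n,m)\circ(s,t)=(n+g^m s,m+t)$. With $(n,m)+(s,t)=(n+g^m s,m+t)$: $D$ (with $\circ=+$); $E$ with $(n,m)\circ(s,t)=(g^t n+g^m s,m+t)$; $F_\gamma$ for integers $1<\gamma\le q$, with $(n,m)\circ(s,t)=(n+(g^\gamma)^m s,m+t)$; $G_\mu$ for integers $1<\mu\le q$, with $(n,m)\circ(s,t)=(g^t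 n+(g^\mu)^m s,m+t)$. *)

theory Defs
  imports "HOL-Algebra.Bij" "HOL-Algebra.Elementary_Groups" "HOL-Number_Theory.Number_Theory"
begin

section \<open>Skew left braces\<close>

text \<open>The additive group \<open>A\<close> (written multiplicatively, and not assumed abelian) and the
  multiplicative group \<open>C\<close>, with operation \<open>\<circ>\<close>, live on one and the same carrier.\<close>

locale skew_left_brace = add: group A + circ: group C
  for A :: "('a, 'm) monoid_scheme" and C :: "('a, 'n) monoid_scheme" +
  assumes carrier_eq: "carrier C = carrier A"
    and brace_compat: "\<lbrakk>a \<in> carrier A; b \<in> carrier A; c \<in> carrier A\<rbrakk> \<Longrightarrow>
      a \<otimes>\<^bsub>C\<^esub> (b \<otimes>\<^bsub>A\<^esub> c) = (a \<otimes>\<^bsub>C\<^esub> b) \<otimes>\<^bsub>A\<^esub> inv\<^bsub>A\<^esub> a \<otimes>\<^bsub>A\<^esub> (a \<otimes>\<^bsub>C\<^esub> c)"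

text \<open>Restricted to the carrier because the elements of \<^const>\<open>AutoGroup\<close> are extensional.\<close>

definition brace_lambda ::
  "('a, 'm) monoid_scheme \<Rightarrow> ('a, 'n) monoid_scheme \<Rightarrow> 'a \<Rightarrow> 'a \<Rightarrow> 'a" where
  "brace_lambda A C a = (\<lambda>b\<in>carrier A. inv\<^bsub>A\<^esub> a \<otimes>\<^bsub>A\<^esub> (a \<otimes>\<^bsub>C\<^esub> b))"


section \<open>Semidirect products\<close>

definition semidirect ::
  "('h, 'm) monoid_scheme \<Rightarrow> ('g, 'n) monoid_scheme \<Rightarrow> ('g \<Rightarrow> 'h \<Rightarrow> 'h) \<Rightarrow> ('h \<times> 'g) monoid" where
  "semidirect H G \<psi> =
    \<lparr>carrier = carrier H \<times> carrier G,
     monoid.mult = (\<lambda>(h1, g1) (h2, g2). (h1 \<otimes>\<^bsub>H\<^esub> \<psi> g1 h2, g1 \<otimes>\<^bsub>G\<^esub> g2)),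
     one = (\<one>\<^bsub>H\<^esub>, \<one>\<^bsub>G\<^esub>)\<rparr>"

definition brace_Lambda ::
  "('a, 'm) monoid_scheme \<Rightarrow> ('a, 'n) monoid_scheme \<Rightarrow> ('a \<times> 'a) monoid" where
  "brace_Lambda A C = semidirect A C (brace_lambda A C)"

lemma AutoGroup_hom_iff:
  "\<psi> \<in> hom G (AutoGroup H) \<longleftrightarrow>
    (\<forall>g\<in>carrier G. \<psi> g \<in> hom H H \<and> \<psi> g \<in> Bij (carrier H)) \<and>
    (\<forall>g\<in>carrier G. \<forall>g'\<in>carrier G. \<psi> (g \<otimes>\<^bsub>G\<^esub> g') = compose (carrier H) (\<psi> g) (\<psi> g'))"
  by (auto simp: hom_def AutoGroup_def auto_def BijGroup_def Pi_iff)

lemma group_semidirect: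
  assumes "group H" "group G" and \<psi>: "\<psi> \<in> hom G (AutoGroup H)"
  shows "group (semidirect H G \<psi>)"
proof -
  interpret H: group H by fact
  interpret G: group G by fact
  note hom = \<psi>[unfolded AutoGroup_hom_iff]
  have cl: "\<psi> g h \<in> carrier H" if "g \<in> carrier G" "h \<in> carrier H" for g h
    using hom that by (auto simp: hom_def)
  have mu: "\<psi> g (h \<otimes>\<^bsub>H\<^esub> h') = \<psi> g h \<otimes>\<^bsub>H\<^esub> \<psi> g h'"
    if "g \<in> carrier G" "h \<in> carrier H" "h' \<in> carrier H" for g h h'
    using hom that by (auto simp: hom_def)
  have co: "\<psi> (g \<otimes>\<^bsub>G\<^esub> g') h = \<psi> g (\<psi> g' h)"
    if "g \<in> carrier G" "g' \<in> carrier G" "h \<in> carrier H" for g g' h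
    using hom that by (auto simp: compose_eq)
  interpret A: group "AutoGroup H" by (rule H.AutoGroup)
  have "\<psi> \<one>\<^bsub>G\<^esub> = \<one>\<^bsub>AutoGroup H\<^esub>"
    using hom_one[OF \<psi>] G.group_axioms A.group_axioms by blast
  then have on: "\<psi> \<one>\<^bsub>G\<^esub> h = h" if "h \<in> carrier H" for h
    using that by (simp add: AutoGroup_def BijGroup_def)
  show ?thesis
  proof (rule groupI)
    fix x assume x: "x \<in> carrier (semidirect H G \<psi>)"
    then obtain h g where [simp]: "x = (h, g)" and hg: "h \<in> carrier H" "g \<in> carrier G"
      by (auto simp: semidirect_def)
    let ?y = "(\<psi> (inv\<^bsub>G\<^esub> g) (inv\<^bsub>H\<^esub> h), inv\<^bsub>G\<^esub> g)"
    have "\<psi> (inv\<^bsub>G\<^esub> g) (inv\<^bsub>H\<^esub> h) \<otimes>\<^bsub>H\<^esub> \<psi> (inv\<^bsub>G\<^esub> g) h = \<psi> (inv\<^bsub>G\<^esub> g) \<one>\<^bsub>H\<^esub>"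
      using hg by (simp flip: mu)
    also have "\<psi> (inv\<^bsub>G\<^esub> g) \<one>\<^bsub>H\<^esub> = \<one>\<^bsub>H\<^esub>"
      using mu[of "inv\<^bsub>G\<^esub> g" "\<one>\<^bsub>H\<^esub>" "\<one>\<^bsub>H\<^esub>"] cl[of "inv\<^bsub>G\<^esub> g" "\<one>\<^bsub>H\<^esub>"] hg
      by simp
    finally show "\<exists>y\<in>carrier (semidirect H G \<psi>). y \<otimes>\<^bsub>semidirect H G \<psi>\<^esub> x = \<one>\<^bsub>semidirect H G \<psi>\<^esub>"
      using hg cl by (intro bexI[of _ ?y]) (auto simp: semidirect_def)
  qed (auto simp: semidirect_def cl mu co on H.m_assoc G.m_assoc)
qed

context skew_left_brace
begin

lemma brace_lambda_hom: "brace_lambda A C \<in> hom C (AutoGroup A)"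
proof -
  let ?l = "brace_lambda A C"
  have [simp]: "a \<otimes>\<^bsub>C\<^esub> b \<in> carrier A" if "a \<in> carrier A" "b \<in> carrier A" for a b
    using that carrier_eq circ.m_closed by auto
  have l: "?l a b = inv\<^bsub>A\<^esub> a \<otimes>\<^bsub>A\<^esub> (a \<otimes>\<^bsub>C\<^esub> b)" if "b \<in> carrier A" for a b
    using that by (simp add: brace_lambda_def)
  have o: "a \<otimes>\<^bsub>C\<^esub> b = a \<otimes>\<^bsub>A\<^esub> ?l a b" if "a \<in> carrier A" "b \<in> carrier A" for a b
    using that by (simp add: l add.m_assoc[symmetric])
  have cl: "?l a b \<in> carrier A" if "a \<in> carrier A" "b \<in> carrier A" for a b
    using that by (simp add: l)
  have mu: "?l a (b \<otimes>\<^bsub>A\<^esub> c) = ?l a b \<otimes>\<^bsub>A\<^esub> ?l a c"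
    if "a \<in> carrier A" "b \<in> carrier A" "c \<in> carrier A" for a b c
    using that by (simp add: l brace_compat add.m_assoc)
  have co: "?l (a \<otimes>\<^bsub>C\<^esub> b) c = ?l a (?l b c)"
    if "a \<in> carrier A" "b \<in> carrier A" "c \<in> carrier A" for a b c
  proof -
    have "(a \<otimes>\<^bsub>C\<^esub> b) \<otimes>\<^bsub>A\<^esub> ?l (a \<otimes>\<^bsub>C\<^esub> b) c = (a \<otimes>\<^bsub>C\<^esub> b) \<otimes>\<^bsub>C\<^esub> c"
      using that by (intro o[symmetric]) auto
    also have "\<dots> = a \<otimes>\<^bsub>C\<^esub> (b \<otimes>\<^bsub>C\<^esub> c)"
      using that by (intro circ.m_assoc) (auto simp: carrier_eq)
    also have "b \<otimes>\<^bsub>C\<^esub> c = b \<otimes>\<^bsub>A\<^esub> ?l b c"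
      using that by (intro o)
    also have "a \<otimes>\<^bsub>C\<^esub> (b \<otimes>\<^bsub>A\<^esub> ?l b c) = a \<otimes>\<^bsub>A\<^esub> ?l a (b \<otimes>\<^bsub>A\<^esub> ?l b c)"
      using that cl by (intro o) auto
    also have "?l a (b \<otimes>\<^bsub>A\<^esub> ?l b c) = ?l a b \<otimes>\<^bsub>A\<^esub> ?l a (?l b c)"
      using that cl by (intro mu) auto
    also have "a \<otimes>\<^bsub>A\<^esub> \<dots> = (a \<otimes>\<^bsub>A\<^esub> ?l a b) \<otimes>\<^bsub>A\<^esub> ?l a (?l b c)"
      using that cl by (intro add.m_assoc[symmetric]) auto
    also have "a \<otimes>\<^bsub>A\<^esub> ?l a b = a \<otimes>\<^bsub>C\<^esub> b"
      using that by (intro o[symmetric])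
    finally show ?thesis
      by (rule add.Units_l_cancel[THEN iffD1, rotated 3]) (use that cl in auto)
  qed
  have bij: "bij_betw (?l a) (carrier A) (carrier A)" if a: "a \<in> carrier A" for a
  proof (rule bij_betw_byWitness[where f' = "\<lambda>b. inv\<^bsub>C\<^esub> a \<otimes>\<^bsub>C\<^esub> (a \<otimes>\<^bsub>A\<^esub> b)"])
    have [simp]: "inv\<^bsub>C\<^esub> a \<in> carrier A" "inv\<^bsub>C\<^esub> a \<in> carrier C" "a \<in> carrier C"
      using a carrier_eq circ.inv_closed by auto
    show "\<forall>b\<in>carrier A. inv\<^bsub>C\<^esub> a \<otimes>\<^bsub>C\<^esub> (a \<otimes>\<^bsub>A\<^esub> ?l a b) = b"
      using a by (simp add: o[symmetric] carrier_eq circ.m_assoc[symmetric])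
    show "\<forall>b\<in>carrier A. ?l a (inv\<^bsub>C\<^esub> a \<otimes>\<^bsub>C\<^esub> (a \<otimes>\<^bsub>A\<^esub> b)) = b"
    proof
      fix b assume b: "b \<in> carrier A"
      have "a \<otimes>\<^bsub>C\<^esub> (inv\<^bsub>C\<^esub> a \<otimes>\<^bsub>C\<^esub> (a \<otimes>\<^bsub>A\<^esub> b)) = a \<otimes>\<^bsub>A\<^esub> b"
        using a b by (simp add: carrier_eq circ.m_assoc[symmetric])
      then show "?l a (inv\<^bsub>C\<^esub> a \<otimes>\<^bsub>C\<^esub> (a \<otimes>\<^bsub>A\<^esub> b)) = b"
        using a b by (simp add: l add.m_assoc[symmetric])
    qed
  qed (use a cl carrier_eq circ.inv_closed in auto)
  have ext: "?l a \<in> extensional (carrier A)" for a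
    by (simp add: brace_lambda_def)
  have "?l (a \<otimes>\<^bsub>C\<^esub> b) = compose (carrier A) (?l a) (?l b)"
    if "a \<in> carrier A" "b \<in> carrier A" for a b
    using that ext by (intro extensionalityI[where A = "carrier A"]) (auto simp: co compose_eq)
  then show ?thesis
    unfolding AutoGroup_hom_iff using cl mu bij ext
    by (auto simp: hom_def Bij_def carrier_eq)
qed

lemma group_brace_Lambda: "group (brace_Lambda A C)"
  unfolding brace_Lambda_def
  by (intro group_semidirect add.group_axioms circ.group_axioms brace_lambda_hom)

end


section \<open>The groups of order \<open>p\<^sup>2 q\<^sup>2\<close>\<close>

abbreviation cyc2 :: "nat \<Rightarrow> (int \<times> int) monoid" where
  "cyc2 n \<equiv> integer_mod_group n \<times>\<times> integer_mod_group n"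

text \<open>The actions of \<open>\<int>\<^sub>q \<times> \<int>\<^sub>q\<close> on \<open>\<int>\<^sub>p \<times> \<int>\<^sub>p\<close>.  Residue classes are represented by the integers
  \<open>0, \<dots>, n - 1\<close>, so exponents in \<open>\<int>\<^sub>q\<close> are nonnegative; they only matter modulo \<open>q\<close>
  when \<open>g\<close> has order \<open>q\<close> modulo \<open>p\<close>.\<close>

definition theta_act :: "nat \<Rightarrow> nat \<Rightarrow> int \<times> int \<Rightarrow> int \<times> int \<Rightarrow> int \<times> int" where
  "theta_act p g = (\<lambda>(x, y). \<lambda>(a, b)\<in>carrier (cyc2 p).
     ((int g ^ nat y * a) mod int p, (int g ^ nat y * b) mod int p))"

definition psi_act :: "nat \<Rightarrow> nat \<Rightarrow> int \<times> int \<Rightarrow> int \<times> int \<Rightarrow> int \<times> int" where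
  "psi_act p g = (\<lambda>(x, y). \<lambda>(a, b)\<in>carrier (cyc2 p).
     ((int g ^ nat x * a) mod int p, (int g ^ nat y * b) mod int p))"

definition xi_act :: "nat \<Rightarrow> nat \<Rightarrow> int \<times> int \<Rightarrow> int \<times> int \<Rightarrow> int \<times> int" where
  "xi_act p g = (\<lambda>(x, y). \<lambda>(a, b)\<in>carrier (cyc2 p).
     ((int g ^ nat x * a + (1 - int g ^ nat x) * b) mod int p, b))"

lemma AutoGroup_homI:
  assumes "group H" "group G"
    and cl: "\<And>g h. \<lbrakk>g \<in> carrier G; h \<in> carrier H\<rbrakk> \<Longrightarrow> \<psi> g h \<in> carrier H"
    and ext: "\<And>g. g \<in> carrier G \<Longrightarrow> \<psi> g \<in> extensional (carrier H)"
    and mu: "\<And>g h h'. \<lbrakk>g \<in> carrier G; h \<in> carrier H; h' \<in> carrier H\<rbrakk> \<Longrightarrow>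
      \<psi> g (h \<otimes>\<^bsub>H\<^esub> h') = \<psi> g h \<otimes>\<^bsub>H\<^esub> \<psi> g h'"
    and co: "\<And>g g' h. \<lbrakk>g \<in> carrier G; g' \<in> carrier G; h \<in> carrier H\<rbrakk> \<Longrightarrow>
      \<psi> (g \<otimes>\<^bsub>G\<^esub> g') h = \<psi> g (\<psi> g' h)"
    and on: "\<And>h. h \<in> carrier H \<Longrightarrow> \<psi> \<one>\<^bsub>G\<^esub> h = h"
  shows "\<psi> \<in> hom G (AutoGroup H)"
proof -
  interpret H: group H by fact
  interpret G: group G by fact
  have "bij_betw (\<psi> g) (carrier H) (carrier H)" if g: "g \<in> carrier G" for g
  proof (rule bij_betw_byWitness[where f' = "\<psi> (inv\<^bsub>G\<^esub> g)"])
    show "\<forall>h\<in>carrier H. \<psi> (inv\<^bsub>G\<^esub> g) (\<psi> g h) = h"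
      using g on co[of "inv\<^bsub>G\<^esub> g" g] by simp
    show "\<forall>h\<in>carrier H. \<psi> g (\<psi> (inv\<^bsub>G\<^esub> g) h) = h"
      using g on co[of g "inv\<^bsub>G\<^esub> g"] by simp
  qed (use g cl in auto)
  moreover have "\<psi> (g \<otimes>\<^bsub>G\<^esub> g') = compose (carrier H) (\<psi> g) (\<psi> g')"
    if "g \<in> carrier G" "g' \<in> carrier G" for g g'
    using that ext by (intro extensionalityI[where A = "carrier H"]) (auto simp: co compose_eq)
  ultimately show ?thesis
    unfolding AutoGroup_hom_iff using cl mu ext by (auto simp: hom_def Bij_def)
qed

lemma int_power_ord_mod:
  assumes "ord p g = q" "0 < q" "0 \<le> x" "0 \<le> y"
  shows "int g ^ nat ((x + y) mod int q) mod int p = (int g ^ nat x * int g ^ nat y) mod int p"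
proof -
  have "nat ((x + y) mod int q) = (nat x + nat y) mod q"
    using assms by (metis nat_add_distrib nat_int nat_mod_distrib add_nonneg_nonneg of_nat_0_le_iff)
  moreover have "coprime p g"
    using assms ord_eq_0[of p g] by auto
  then have "[g ^ ((nat x + nat y) mod q) = g ^ (nat x + nat y)] (mod p)"
    using assms by (subst order_divides_expdiff) (auto simp: cong_def)
  ultimately show ?thesis
    by (metis cong_def of_nat_mod of_nat_power power_add)
qed

context
  fixes p q g :: nat
  assumes p: "1 < p" and q: "0 < q" and g: "ord p g = q"
begin

private lemma grp: "group (cyc2 n)"
  by (simp add: DirProd_group)

private lemma lin: "(c * ((a + a') mod int p)) mod int p = ((c * a) mod int p + (c * a') mod int p) mod int p"
  by (simp add: mod_simps distrib_left)

private lemma pw: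
  assumes "0 \<le> x" "0 \<le> y"
  shows "(int g ^ nat ((x + y) mod int q) * a) mod int p = (int g ^ nat x * (int g ^ nat y * a mod int p)) mod int p"
proof -
  have "(int g ^ nat ((x + y) mod int q) * a) mod int p =
      ((int g ^ nat ((x + y) mod int q) mod int p) * a) mod int p"
    by (simp add: mod_simps)
  also have "\<dots> = (int g ^ nat x * (int g ^ nat y * a mod int p)) mod int p"
    unfolding int_power_ord_mod[OF g q assms] by (simp add: mod_simps mult.assoc)
  finally show ?thesis .
qed

private lemma xi_alt: "(u * a + (1 - u) * b) mod int p = (u * (a - b) mod int p + b) mod int p"
  for u a b :: int
proof -
  have "u * a + (1 - u) * b = u * (a - b) + b"
    by (simp add: algebra_simps)
  then show ?thesis
    by (simp only: mod_add_left_eq)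
qed

lemma theta_act_hom: "theta_act p g \<in> hom (cyc2 q) (AutoGroup (cyc2 p))"
  by (rule AutoGroup_homI[OF grp grp])
    (use p q in \<open>auto simp: theta_act_def carrier_integer_mod_group lin pw\<close>)

lemma psi_act_hom: "psi_act p g \<in> hom (cyc2 q) (AutoGroup (cyc2 p))"
  by (rule AutoGroup_homI[OF grp grp])
    (use p q in \<open>auto simp: psi_act_def carrier_integer_mod_group lin pw\<close>)

private lemma xi_add:
  "(u * ((a + a') mod int p) + (1 - u) * ((b + b') mod int p)) mod int p =
   ((u * a + (1 - u) * b) mod int p + (u * a' + (1 - u) * b') mod int p) mod int p"
proof -
  have "(u * ((a + a') mod int p) + (1 - u) * ((b + b') mod int p)) mod int p =
      (u * (a + a') + (1 - u) * (b + b')) mod int p"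
    by (intro mod_add_cong mod_mult_right_eq)
  also have "u * (a + a') + (1 - u) * (b + b') = (u * a + (1 - u) * b) + (u * a' + (1 - u) * b')"
    by (simp add: algebra_simps)
  finally show ?thesis
    by (simp only: mod_add_eq)
qed

private lemma xi_comp:
  assumes "0 \<le> x" "0 \<le> y"
  shows "(int g ^ nat ((x + y) mod int q) * a + (1 - int g ^ nat ((x + y) mod int q)) * b) mod int p =
    (int g ^ nat x * ((int g ^ nat y * a + (1 - int g ^ nat y) * b) mod int p) +
      (1 - int g ^ nat x) * b) mod int p"
proof -
  let ?z = "int g ^ nat ((x + y) mod int q)" and ?x = "int g ^ nat x" and ?y = "int g ^ nat y"
  have "(?z * a + (1 - ?z) * b) mod int p = (?z * (a - b) mod int p + b) mod int p"
    by (simp add: xi_alt)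
  also have "\<dots> = (?x * (?y * (a - b)) + b) mod int p"
    unfolding pw[OF assms] by (simp add: mod_simps)
  also have "?x * (?y * (a - b)) + b = ?x * (?y * a + (1 - ?y) * b) + (1 - ?x) * b"
    by (simp add: algebra_simps)
  also have "\<dots> mod int p = (?x * ((?y * a + (1 - ?y) * b) mod int p) + (1 - ?x) * b) mod int p"
    by (intro mod_add_cong mod_mult_right_eq[symmetric] refl)
  finally show ?thesis .
qed

lemma xi_act_hom: "xi_act p g \<in> hom (cyc2 q) (AutoGroup (cyc2 p))"
  by (rule AutoGroup_homI[OF grp grp])
    (use p q in \<open>auto simp: xi_act_def carrier_integer_mod_group xi_add xi_comp\<close>)

end

end

theory Submission
  imports Defs "HOL-Algebra.Sylow"
begin

text \<open>The additive group has a unique subgroup \<open>P = \<langle>x\<rangle>\<close> of order \<open>p\<close>. It is characteristic, so it is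
  also the subgroup of order \<open>p\<close> of the multiplicative group. An element \<open>c\<close> of multiplicative order
  \<open>q\<close> acts through \<open>\<lambda>\<^sub>c\<close> on the additive group; counting orbits shows that it fixes an element
  \<open>a\<close> of additive order \<open>q\<close>. Likewise \<open>\<lambda>\<^sub>x\<close> fixes \<open>x\<close> and the cosets of \<open>P\<close>. Hence \<open>(x, 1)\<close>, \<open>(1, x)\<close>
  commute, \<open>(a, 1)\<close>, \<open>(1, c)\<close> commute, and the latter pair acts on the span of the former by triangular
  matrices over \<open>\<int>\<^sub>p\<close>, with two characters of \<open>\<int>\<^sub>q \<times> \<int>\<^sub>q\<close> on the diagonal. If both are trivial, the
  group is \<open>\<int>\<^sub>p\<^sub>q \<times> \<int>\<^sub>p\<^sub>q\<close>; if they are independent, equal, or exactly one of them is trivial, it is the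
  \<open>\<psi>\<close>-, \<open>\<theta>\<close>- or \<open>\<xi>\<close>-product. The remaining pairs of characters could only occur when the additive group is
  abelian, and there the brace identity forces the two characters to coincide. The classification of
  skew left braces of order \<open>pq\<close> is not needed.\<close>

section \<open>Roots of unity modulo a prime\<close>

text \<open>The order divides the prime \<open>q\<close> by the first congruence and is not 1 by the
  second. The reduction \<open>nat (s mod int p)\<close> carries integer exponents over to the
  naturals, where \<open>Pocklington.ord\<close> lives.\<close>

lemma ord_root_of_unity:
  fixes s :: int and p q :: nat
  assumes "0 < p" and q: "Factorial_Ring.prime q"
    and s: "[s ^ q = 1] (mod int p)" "\<not> [s = 1] (mod int p)"
  shows "Pocklington.ord p (nat (s mod int p)) = q"
proof -
  define t where "t = nat (s mod int p)"
  have t: "[int t = s] (mod int p)"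
    using assms(1) by (simp add: t_def cong_def)
  have "[int t ^ q = 1] (mod int p)"
    using cong_pow[OF t] s(1) by (rule cong_trans)
  then have "[t ^ q = 1] (mod p)"
    by (simp flip: cong_int_iff)
  then have "Pocklington.ord p t dvd q"
    by (simp only: ord_divides)
  moreover have "Pocklington.ord p t \<noteq> 1"
  proof
    assume "Pocklington.ord p t = 1"
    then have "[t ^ 1 = 1] (mod p)"
      using ord_divides[of t 1 p] by simp
    then have "[int t = 1] (mod int p)"
      by (simp flip: cong_int_iff)
    then show False
      using s(2) t cong_trans cong_sym by blast
  qed
  ultimately show ?thesis
    using q prime_nat_iff unfolding t_def by blast
qed

text \<open>By Euler's theorem the order \<open>q\<close> of the residue divides
  \<open>p - 1\<close>. Any nontrivial action thus yields the side condition on \<open>p\<close> and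
  \<open>q\<close>.\<close>

lemma cong_1_of_root_of_unity:
  fixes s :: int and p q :: nat
  assumes p: "Factorial_Ring.prime p" and q: "Factorial_Ring.prime q"
    and s: "[s ^ q = 1] (mod int p)" "\<not> [s = 1] (mod int p)"
  shows "[p = 1] (mod q)"
proof -
  have ord: "Pocklington.ord p (nat (s mod int p)) = q"
    using p q s by (intro ord_root_of_unity) (auto intro: prime_gt_0_nat)
  then have "coprime p (nat (s mod int p))"
    using q ord_eq_0[of p "nat (s mod int p)"] by auto
  then have "q dvd p - 1"
    using order_divides_totient[of p "nat (s mod int p)"] ord p by (simp add: totient_prime)
  then show ?thesis
    using p by (metis cong_to_1'_nat cong_altdef_nat prime_ge_1_nat)
qed

text \<open>The powers of \<open>s\<close> already give \<open>q\<close> distinct solutions of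
  \<open>z ^ q = 1\<close> modulo \<open>p\<close>, and there are at most \<open>q\<close> of
  them.\<close>

lemma root_of_unity_is_power:
  fixes r s :: int and p q :: nat
  assumes p: "Factorial_Ring.prime p" and q: "Factorial_Ring.prime q"
    and s: "[s ^ q = 1] (mod int p)" "\<not> [s = 1] (mod int p)" and r: "[r ^ q = 1] (mod int p)"
  obtains n :: nat where "[s ^ n = r] (mod int p)"
proof -
  define t where "t = (\<lambda>z :: int. nat (z mod int p))"
  have p0: "0 < p" and q0: "0 < q" using p q by (auto intro: prime_gt_0_nat)
  have t: "[int (t z) = z] (mod int p)" "t z < p" for z
    using p0 by (simp_all add: t_def cong_def nat_less_iff)
  have tq: "[t z ^ q = 1] (mod p)" if "[z ^ q = 1] (mod int p)" for z
  proof -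
    have "[int (t z) ^ q = 1] (mod int p)"
      using cong_pow[OF t(1)] that by (rule cong_trans)
    then show ?thesis
      by (simp flip: cong_int_iff)
  qed
  have ord: "Pocklington.ord p (t s) = q"
    using ord_root_of_unity[OF p0 q s] by (simp add: t_def)
  let ?A = "{z \<in> {..<p}. [z ^ q = 1] (mod p)}" and ?f = "\<lambda>n. t s ^ n mod p"
  have cop: "coprime p (t s)"
    using ord q0 ord_eq_0[of p "t s"] by auto
  have "inj_on ?f {..<q}"
  proof (rule inj_onI)
    fix m n assume "m \<in> {..<q}" "n \<in> {..<q}" "?f m = ?f n"
    then show "m = n"
      using order_divides_expdiff[OF cop, of m n] ord by (simp add: cong_def)
  qed
  then have "card (?f ` {..<q}) = q"
    by (simp add: card_image)
  moreover have "?f ` {..<q} \<subseteq> ?A"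
  proof -
    have "[(t s ^ n) ^ q = 1] (mod p)" for n
      using cong_pow[OF tq[OF s(1)], of n] by (simp add: mult.commute flip: power_mult)
    then show ?thesis
      using p0 by (auto simp: cong_def power_mod)
  qed
  moreover have "card ?A \<le> q"
    using p q0 by (rule roots_mod_prime_bound)
  ultimately have "?f ` {..<q} = ?A"
    by (intro card_seteq) auto
  moreover have "t r \<in> ?A"
    using tq[OF r] t(2) by simp
  ultimately obtain n where "t r = t s ^ n mod p"
    by blast
  then have "[int (t r) = int (t s) ^ n] (mod int p)"
    by (simp add: cong_def zmod_int)
  then have "[s ^ n = r] (mod int p)"
    using t(1) cong_pow cong_sym cong_trans by meson
  then show thesis
    by (rule that)
qed

section \<open>Groups generated by two commuting pairs\<close>

context group
begin

lemma conjugation_hom: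
  assumes "u \<in> carrier G"
  shows "(\<lambda>x. u \<otimes> x \<otimes> inv u) \<in> hom G G"
  using assms by (auto simp: hom_def m_assoc simp flip: m_assoc[of "inv u"])

text \<open>Conjugation by \<open>u\<close> is a homomorphism taking \<open>x\<close> to
  \<open>z\<close>. Here and below, actions are recorded without inverses, as rules for moving
  \<open>u\<close> past \<open>x\<close>.\<close>

lemma twist_int_pow:
  assumes "u \<in> carrier G" "x \<in> carrier G" "z \<in> carrier G" "u \<otimes> x = z \<otimes> u"
  shows "u \<otimes> x [^] (a :: int) = z [^] a \<otimes> u"
proof -
  have "u \<otimes> x [^] a \<otimes> inv u = (u \<otimes> x \<otimes> inv u) [^] a"
    using conjugation_hom[OF assms(1)] hom_int_pow[of _ G G x a] assms(2) group_axioms by auto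
  moreover have "u \<otimes> x \<otimes> inv u = z"
    by (simp add: assms(4)) (simp add: assms(1-3) m_assoc)
  ultimately show ?thesis
    using assms(1-3) by (simp add: inv_solve_right')
qed

text \<open>Each conjugation by \<open>u\<close> multiplies exponents of \<open>x\<close> by
  \<open>i\<close>, so \<open>n\<close> of them multiply by \<open>i ^ n\<close>.\<close>

lemma twist_nat_pow:
  assumes "u \<in> carrier G" "x \<in> carrier G" "u \<otimes> x = x [^] (i :: int) \<otimes> u"
  shows "u [^] (n :: nat) \<otimes> x [^] (a :: int) = x [^] (i ^ n * a) \<otimes> u [^] n"
proof (induction n arbitrary: a)
  case (Suc n)
  have "u [^] Suc n \<otimes> x [^] a = u [^] n \<otimes> (u \<otimes> x [^] a)"
    using assms by (simp add: m_assoc)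
  also have "u \<otimes> x [^] a = x [^] (i * a) \<otimes> u"
    using twist_int_pow[of u x "x [^] i" a] assms by (simp add: int_pow_pow)
  also have "u [^] n \<otimes> (x [^] (i * a) \<otimes> u) = u [^] n \<otimes> x [^] (i * a) \<otimes> u"
    using assms by (simp add: m_assoc)
  also have "\<dots> = x [^] (i ^ Suc n * a) \<otimes> u [^] Suc n"
    using assms by (simp add: Suc m_assoc mult_ac)
  finally show ?case .
qed (use assms in simp)

lemma ord_prime_eq:
  assumes "x \<in> carrier G" "Factorial_Ring.prime n" "x [^] (n :: nat) = \<one>" "x \<noteq> \<one>"
  shows "ord x = n"
  using assms pow_eq_id prime_nat_iff ord_eq_1 by blast

lemma int_pow_cong:
  assumes "x \<in> carrier G" "x [^] (n :: nat) = \<one>" "[a = b] (mod int n)"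
  shows "x [^] (a :: int) = x [^] b"
proof -
  have "int (ord x) dvd int n"
    using assms by (simp add: pow_eq_id)
  also have "int n dvd b - a"
    using assms(3) by (simp add: cong_sym cong_iff_dvd_diff[symmetric])
  finally show ?thesis
    using assms(1) by (simp add: int_pow_eq)
qed

lemma int_pow_mod:
  assumes "x \<in> carrier G" "x [^] (n :: nat) = \<one>"
  shows "x [^] (a mod int n :: int) = x [^] a"
  by (rule int_pow_cong[OF assms]) (simp add: cong_def)

text \<open>Addition in \<open>cyc2 n\<close> reduces modulo \<open>n\<close>, which is harmless
  because both \<open>n\<close>-th powers vanish.\<close>

lemma cyc2_hom:
  assumes "x \<in> carrier G" "y \<in> carrier G" "x \<otimes> y = y \<otimes> x" "x [^] (n :: nat) = \<one>" "y [^] n = \<one>"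
  shows "(\<lambda>(a, b). x [^] a \<otimes> y [^] b) \<in> hom (cyc2 n) G"
proof -
  have comm: "y [^] b \<otimes> x [^] a = x [^] a \<otimes> y [^] b" for a b :: int
    using twist_int_pow[of "y [^] b" x x a] twist_int_pow[of x y y b] assms by simp
  have "x [^] (a + a') \<otimes> y [^] (b + b') = x [^] a \<otimes> y [^] b \<otimes> (x [^] a' \<otimes> y [^] b')"
    for a a' b b' :: int
  proof -
    have "x [^] (a + a') \<otimes> y [^] (b + b') = x [^] a \<otimes> (x [^] a' \<otimes> y [^] b) \<otimes> y [^] b'"
      using assms by (simp add: int_pow_mult m_assoc)
    also have "x [^] a' \<otimes> y [^] b = y [^] b \<otimes> x [^] a'"
      by (simp add: comm)
    finally show ?thesis
      using assms by (simp add: m_assoc)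
  qed
  then show ?thesis
    using assms by (auto simp: hom_def int_pow_mod)
qed

text \<open>The image is a subgroup containing generators, so the map is onto; equal finite orders
  then make it injective.\<close>

lemma iso_of_generating_hom:
  assumes h: "h \<in> hom H G" and "group H" and "order H = order G" "finite (carrier H)"
    and "S \<subseteq> h ` carrier H" "carrier G \<subseteq> generate G S"
  shows "G \<cong> H"
proof -
  interpret H: group H by fact
  interpret h: group_hom H G h
    using h by unfold_locales
  have "carrier G \<subseteq> h ` carrier H"
    using generate_subgroup_incl[OF assms(5) h.img_is_subgroup] assms(6) by blast
  then have surj: "h ` carrier H = carrier G"
    by auto
  then have "inj_on h (carrier H)"
    using assms(3,4) by (intro eq_card_imp_inj_on) (auto simp: order_def)
  then have "h \<in> iso H G"
    using h surj by (auto simp: iso_def bij_betw_def)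
  then show ?thesis
    using H.iso_sym is_isoI by blast
qed

end

text \<open>The way in which \<open>u\<close> and \<open>v\<close> act on \<open>x\<close> and
  \<open>y\<close> is left open and supplied lemma by lemma. The prescribed order takes the place of
  any independence condition on the generators.\<close>

locale commuting_pairs = group G for G (structure) +
  fixes p q :: nat and x y u v
  assumes p0: "1 < p" and q0: "1 < q"
    and carr [simp]: "x \<in> carrier G" "y \<in> carrier G" "u \<in> carrier G" "v \<in> carrier G"
    and pow: "x [^] p = \<one>" "y [^] p = \<one>" "u [^] q = \<one>" "v [^] q = \<one>"
    and comm: "x \<otimes> y = y \<otimes> x" "u \<otimes> v = v \<otimes> u"
    and gen: "carrier G \<subseteq> generate G {x, y, u, v}"
    and order: "order G = (p * q)\<^sup>2"
begin

abbreviation X where "X \<equiv> \<lambda>(a :: int, b :: int). x [^] a \<otimes> y [^] b"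
abbreviation U where "U \<equiv> \<lambda>(c :: int, d :: int). u [^] c \<otimes> v [^] d"

text \<open>The relation \<open>compat\<close> says that \<open>U k\<close> conjugates
  \<open>X h\<close> as \<open>act k\<close> prescribes, which is exactly what makes
  \<open>(h, k) \<mapsto> X h \<otimes> U k\<close> multiplicative. Generation and counting do the
  rest.\<close>

lemma iso_semidirect:
  assumes act: "act \<in> hom (cyc2 q) (AutoGroup (cyc2 p))"
    and compat: "\<And>k h. k \<in> carrier (cyc2 q) \<Longrightarrow> h \<in> carrier (cyc2 p) \<Longrightarrow> U k \<otimes> X h = X (act k h) \<otimes> U k"
  shows "G \<cong> semidirect (cyc2 p) (cyc2 q) act"
proof -
  let ?S = "semidirect (cyc2 p) (cyc2 q) act"
  let ?h = "\<lambda>(h, k). X h \<otimes> U k"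
  have grp: "group (cyc2 n)" for n
    by (simp add: DirProd_group)
  have X: "X \<in> hom (cyc2 p) G" and U: "U \<in> hom (cyc2 q) G"
    by (rule cyc2_hom; simp add: pow comm)+
  have Xc: "X h \<in> carrier G" and Uc: "U h \<in> carrier G" for h
    by (auto split: prod.split)
  have ac: "act k h \<in> carrier (cyc2 p)" if "k \<in> carrier (cyc2 q)" "h \<in> carrier (cyc2 p)" for h k
    using act[unfolded AutoGroup_hom_iff] that unfolding hom_def by blast
  have "?h \<in> hom ?S G"
  proof (rule homI)
    fix s t assume "s \<in> carrier ?S" "t \<in> carrier ?S"
    then obtain h k h' k' where st: "s = (h, k)" "t = (h', k')"
      and c: "h \<in> carrier (cyc2 p)" "h' \<in> carrier (cyc2 p)" "k \<in> carrier (cyc2 q)" "k' \<in> carrier (cyc2 q)"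
      unfolding semidirect_def by auto
    have "X (h \<otimes>\<^bsub>cyc2 p\<^esub> act k h') \<otimes> U (k \<otimes>\<^bsub>cyc2 q\<^esub> k') = X h \<otimes> X (act k h') \<otimes> (U k \<otimes> U k')"
      using hom_mult[OF X, of h "act k h'"] hom_mult[OF U, of k k'] c ac by simp
    also have "\<dots> = X h \<otimes> (X (act k h') \<otimes> U k) \<otimes> U k'"
      using Xc Uc by (simp add: m_assoc del: split_paired_All)
    also have "\<dots> = X h \<otimes> U k \<otimes> (X h' \<otimes> U k')"
      using Xc Uc by (subst compat[symmetric]) (use c in \<open>simp_all add: m_assoc\<close>)
    finally show "?h (s \<otimes>\<^bsub>?S\<^esub> t) = ?h s \<otimes> ?h t"
      by (simp add: semidirect_def st)
  qed (auto simp: semidirect_def)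
  moreover have "group ?S"
    by (intro group_semidirect grp act)
  moreover have "order ?S = order G"
    unfolding order using p0 q0
    by (simp add: order_def semidirect_def carrier_integer_mod_group power2_eq_square)
  moreover have "finite (carrier ?S)"
    using p0 q0 by (simp add: semidirect_def carrier_integer_mod_group)
  moreover have "{x, y, u, v} \<subseteq> ?h ` carrier ?S"
  proof -
    have "{((1, 0), (0, 0)), ((0, 1), (0, 0)), ((0, 0), (1, 0)), ((0, 0), (0, 1))} \<subseteq> carrier ?S"
      using p0 q0 by (simp add: semidirect_def carrier_integer_mod_group)
    then have "?h ` {((1, 0), (0, 0)), ((0, 1), (0, 0)), ((0, 0), (1, 0)), ((0, 0), (0, 1))} \<subseteq> ?h ` carrier ?S"
      by (rule image_mono)
    then show ?thesis
      by simp
  qed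
  ultimately show ?thesis
    using gen by (rule iso_of_generating_hom)
qed

text \<open>When all four generators commute, \<open>x \<otimes> u\<close> and
  \<open>y \<otimes> v\<close> have exponent \<open>p * q\<close> and generate the group, by the
  Chinese remainder theorem.\<close>

lemma iso_cyc2:
  assumes "coprime p q" "u \<otimes> x = x \<otimes> u" "u \<otimes> y = y \<otimes> u" "v \<otimes> x = x \<otimes> v" "v \<otimes> y = y \<otimes> v"
  shows "G \<cong> cyc2 (p * q)"
proof -
  have xu: "(x \<otimes> u) [^] a = x [^] a \<otimes> u [^] a" and yv: "(y \<otimes> v) [^] a = y [^] a \<otimes> v [^] a" for a :: int
    using assms by (simp_all add: int_pow_mult_distrib)
  have one: "z [^] (p * q) = \<one>" if "z \<in> carrier G" "z [^] p = \<one> \<or> z [^] q = \<one>" for z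
    using that pow_eq_id by (meson dvd_mult dvd_mult2)
  have "(x \<otimes> u) \<otimes> (y \<otimes> v) = (y \<otimes> v) \<otimes> (x \<otimes> u)"
  proof -
    have "(x \<otimes> u) \<otimes> (y \<otimes> v) = x \<otimes> (u \<otimes> y) \<otimes> v"
      by (simp add: m_assoc)
    also have "\<dots> = (x \<otimes> y) \<otimes> (u \<otimes> v)"
      by (simp add: assms m_assoc)
    also have "\<dots> = y \<otimes> (x \<otimes> v) \<otimes> u"
      by (simp add: comm m_assoc)
    also have "\<dots> = (y \<otimes> v) \<otimes> (x \<otimes> u)"
      by (simp add: assms(4)[symmetric] m_assoc)
    finally show ?thesis .
  qed
  then have hom: "(\<lambda>(a, b). (x \<otimes> u) [^] a \<otimes> (y \<otimes> v) [^] b) \<in> hom (cyc2 (p * q)) G" (is "?h \<in> _")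
    using pow assms by (intro cyc2_hom) (simp_all add: pow_mult_distrib one)
  interpret C: group "cyc2 (p * q)"
    by (simp add: DirProd_group)
  interpret h: group_hom "cyc2 (p * q)" G ?h
    using hom by unfold_locales
  define K where "K = ?h ` carrier (cyc2 (p * q))"
  have sub: "subgroup K G"
    unfolding K_def by (rule h.img_is_subgroup)
  have "1 < int p * int q"
    using p0 q0 by (intro less_1_mult) auto
  then have "{(1, 0), (0, 1)} \<subseteq> carrier (cyc2 (p * q))"
    by (simp add: carrier_integer_mod_group)
  then have "?h ` {(1, 0), (0, 1)} \<subseteq> K"
    unfolding K_def by (rule image_mono)
  then have K: "x \<otimes> u \<in> K" "y \<otimes> v \<in> K"
    by simp_all
  \<comment> \<open>The exponent \<open>int q * r\<close> is 1 modulo \<open>p\<close> and 0 modulo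
    \<open>q\<close>, so it extracts \<open>x\<close> from \<open>x \<otimes> u\<close>;
    \<open>int p * s\<close> extracts \<open>u\<close>.\<close>
  obtain r where r: "[int q * r = 1] (mod int p)"
    using cong_solve_coprime_int[of "int q" "int p"] assms(1) by (auto simp: coprime_commute)
  obtain s where s: "[int p * s = 1] (mod int q)"
    using cong_solve_coprime_int[of "int p" "int q"] assms(1) by auto
  have z: "z [^] (int n * a) = \<one>" if "z \<in> carrier G" "z [^] n = \<one>" for z a and n :: nat
    using that by (simp add: int_pow_int flip: int_pow_pow)
  have "x = (x \<otimes> u) [^] (int q * r)" "u = (x \<otimes> u) [^] (int p * s)"
       "y = (y \<otimes> v) [^] (int q * r)" "v = (y \<otimes> v) [^] (int p * s)"
    unfolding xu yv
    using int_pow_cong[OF _ pow(1) r] int_pow_cong[OF _ pow(2) r]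
      int_pow_cong[OF _ pow(3) s] int_pow_cong[OF _ pow(4) s]
    by (simp_all only: z pow carr int_pow_1 l_one r_one int_pow_closed)
  then have "x \<in> K" "u \<in> K" "y \<in> K" "v \<in> K"
    using subgroup_int_pow_closed[OF sub] K by metis+
  then have "{x, y, u, v} \<subseteq> K"
    by simp
  moreover have "order (cyc2 (p * q)) = order G"
    unfolding order using p0 q0
    by (simp add: order_def carrier_integer_mod_group power2_eq_square nat_mult_distrib)
  moreover have "finite (carrier (cyc2 (p * q)))"
    using p0 q0 by (simp add: carrier_integer_mod_group)
  ultimately show ?thesis
    using hom gen unfolding K_def
    by (intro iso_of_generating_hom[of ?h _ "{x, y, u, v}"]) (auto simp: DirProd_group)
qed

text \<open>Both actions are diagonal, so their eigenvalues multiply. The three model actions use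
  this one computation with different eigenvalues.\<close>

lemma U_X:
  assumes "u \<otimes> x = x [^] (i :: int) \<otimes> u" "u \<otimes> y = y [^] (j :: int) \<otimes> u"
    and "v \<otimes> x = x [^] (k :: int) \<otimes> v" "v \<otimes> y = y [^] (l :: int) \<otimes> v"
    and "0 \<le> c" "0 \<le> d"
  shows "U (c, d) \<otimes> X (a, b) = X (i ^ nat c * k ^ nat d * a, j ^ nat c * l ^ nat d * b) \<otimes> U (c, d)"
proof -
  have *: "w [^] n \<otimes> X (a, b) = X (i ^ n * a, j ^ n * b) \<otimes> w [^] n"
    if "w \<in> carrier G" "w \<otimes> x = x [^] (i :: int) \<otimes> w" "w \<otimes> y = y [^] (j :: int) \<otimes> w"
    for w i j a b and n :: nat
  proof -
    have "w [^] n \<otimes> X (a, b) = (w [^] n \<otimes> x [^] a) \<otimes> y [^] b"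
      using that by (simp add: m_assoc)
    also have "\<dots> = x [^] (i ^ n * a) \<otimes> (w [^] n \<otimes> y [^] b)"
      using that by (simp add: twist_nat_pow m_assoc)
    also have "\<dots> = X (i ^ n * a, j ^ n * b) \<otimes> w [^] n"
      using that by (simp add: twist_nat_pow m_assoc)
    finally show ?thesis .
  qed
  have "U (c, d) \<otimes> X (a, b) = u [^] nat c \<otimes> (v [^] nat d \<otimes> X (a, b))"
    using assms(5,6) by (simp add: pow_nat m_assoc)
  also have "\<dots> = (u [^] nat c \<otimes> X (k ^ nat d * a, l ^ nat d * b)) \<otimes> v [^] nat d"
    using assms by (subst *[of v k l]) (simp_all add: m_assoc)
  also have "\<dots> = X (i ^ nat c * (k ^ nat d * a), j ^ nat c * (l ^ nat d * b)) \<otimes> u [^] nat c \<otimes> v [^] nat d"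
    using assms by (subst *[of u i j]) simp_all
  finally show ?thesis
    using assms(5,6) by (simp add: pow_nat m_assoc mult.assoc)
qed

text \<open>Order and exponents aside, it is enough to recover the old generators from the new
  ones.\<close>

lemma change_generators:
  assumes "{x', y', u', v'} \<subseteq> carrier G"
    and "x' [^] p = \<one>" "y' [^] p = \<one>" "u' [^] q = \<one>" "v' [^] q = \<one>"
    and "x' \<otimes> y' = y' \<otimes> x'" "u' \<otimes> v' = v' \<otimes> u'"
    and "{x, y, u, v} \<subseteq> generate G {x', y', u', v'}"
  shows "commuting_pairs G p q x' y' u' v'"
proof -
  have "generate G {x, y, u, v} \<subseteq> generate G {x', y', u', v'}"
    using assms by (intro generate_subgroup_incl generate_is_subgroup) auto
  then show ?thesis
    using assms gen p0 q0 order by unfold_locales auto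
qed

text \<open>Raising to an inverse of \<open>n\<close> modulo \<open>q\<close> recovers
  \<open>w\<close>.\<close>

lemma pow_in_generate:
  assumes "w \<in> carrier G" "w [^] q = \<one>" "coprime n q" "w [^] (n :: nat) \<in> generate G S" "S \<subseteq> carrier G"
  shows "w \<in> generate G S"
proof -
  obtain m where m: "[int n * m = 1] (mod int q)"
    using cong_solve_coprime_int[of "int n" "int q"] assms(3) by auto
  have "(w [^] n) [^] m = w [^] (int n * m)"
    using assms(1) by (simp add: int_pow_int flip: int_pow_pow)
  also have "\<dots> = w"
    using int_pow_cong[OF assms(1,2) m] assms(1) by simp
  finally show ?thesis
    using subgroup_int_pow_closed[OF generate_is_subgroup[OF assms(5)] assms(4), of m] by simp
qed

lemma power_u:
  assumes "coprime n q"
  shows "commuting_pairs G p q x y (u [^] (n :: nat)) v"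
proof (rule change_generators)
  show "(u [^] n) [^] q = \<one>"
    using pow by (metis carr(3) nat_pow_one nat_pow_pow mult.commute)
  show "{x, y, u, v} \<subseteq> generate G {x, y, u [^] n, v}"
    using pow_in_generate[of u n "{x, y, u [^] n, v}"] assms pow by (auto intro: generate.incl)
qed (use pow comm in \<open>auto simp: group_commutes_pow\<close>)

lemma power_v:
  assumes "coprime n q"
  shows "commuting_pairs G p q x y u (v [^] (n :: nat))"
proof (rule change_generators)
  show "(v [^] n) [^] q = \<one>"
    using pow by (metis carr(4) nat_pow_one nat_pow_pow mult.commute)
  show "{x, y, u, v} \<subseteq> generate G {x, y, u, v [^] n}"
    using pow_in_generate[of v n "{x, y, u, v [^] n}"] assms pow by (auto intro: generate.incl)
  show "u \<otimes> v [^] n = v [^] n \<otimes> u"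
    using comm by (simp add: group_commutes_pow)
qed (use pow comm in auto)

section \<open>Recognizing the three nonabelian target groups from their eigenvalues\<close>

lemma iso_theta:
  assumes "u \<otimes> x = x \<otimes> u" "u \<otimes> y = y \<otimes> u"
    and "v \<otimes> x = x [^] int g \<otimes> v" "v \<otimes> y = y [^] int g \<otimes> v"
    and "Pocklington.ord p g = q"
  shows "G \<cong> semidirect (cyc2 p) (cyc2 q) (theta_act p g)"
proof (rule iso_semidirect)
  show "theta_act p g \<in> hom (cyc2 q) (AutoGroup (cyc2 p))"
    using p0 q0 assms(5) by (intro theta_act_hom) auto
  fix k h assume "k \<in> carrier (cyc2 q)" "h \<in> carrier (cyc2 p)"
  then show "U k \<otimes> X h = X (theta_act p g k h) \<otimes> U k"
    using p0 q0 U_X[of 1 1 "int g" "int g" "fst k" "snd k" "fst h" "snd h"] assms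
    by (auto simp: theta_act_def carrier_integer_mod_group int_pow_mod pow)
qed

lemma iso_psi:
  assumes "u \<otimes> x = x [^] int g \<otimes> u" "u \<otimes> y = y \<otimes> u"
    and "v \<otimes> x = x \<otimes> v" "v \<otimes> y = y [^] int g \<otimes> v"
    and "Pocklington.ord p g = q"
  shows "G \<cong> semidirect (cyc2 p) (cyc2 q) (psi_act p g)"
proof (rule iso_semidirect)
  show "psi_act p g \<in> hom (cyc2 q) (AutoGroup (cyc2 p))"
    using p0 q0 assms(5) by (intro psi_act_hom) auto
  fix k h assume "k \<in> carrier (cyc2 q)" "h \<in> carrier (cyc2 p)"
  then show "U k \<otimes> X h = X (psi_act p g k h) \<otimes> U k"
    using p0 q0 U_X[of "int g" 1 1 "int g" "fst k" "snd k" "fst h" "snd h"] assms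
    by (auto simp: psi_act_def carrier_integer_mod_group int_pow_mod pow)
qed

text \<open>The matrix of the action \<^const>\<open>xi_act\<close> has the eigenvectors \<open>(1, 0)\<close> and \<open>(1, 1)\<close>, so for
  eigenvectors \<open>x\<close>, \<open>y\<close> the basis to use is \<open>x\<close>, \<open>y x\<^sup>-\<^sup>1\<close>.\<close>

lemma iso_xi:
  assumes "u \<otimes> x = x [^] int g \<otimes> u" "u \<otimes> y = y \<otimes> u"
    and "v \<otimes> x = x \<otimes> v" "v \<otimes> y = y \<otimes> v"
    and "Pocklington.ord p g = q"
  shows "G \<cong> semidirect (cyc2 p) (cyc2 q) (xi_act p g)"
proof -
  have comm': "x \<otimes> (y \<otimes> inv x) = (y \<otimes> inv x) \<otimes> x"
  proof -
    have "x \<otimes> (y \<otimes> inv x) = (y \<otimes> x) \<otimes> inv x"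
      by (simp add: comm(1) flip: m_assoc)
    then show ?thesis
      by (simp add: m_assoc)
  qed
  have xy: "(y \<otimes> inv x) [^] b = x [^] (- b) \<otimes> y [^] b" for b :: int
  proof -
    have "inv x \<otimes> y = y \<otimes> inv x"
      using twist_int_pow[of y x x "- 1"] comm by (simp add: int_pow_neg)
    then show ?thesis
      using int_pow_mult_distrib[of "inv x" y b] by (simp add: int_pow_inv int_pow_neg)
  qed
  interpret E: commuting_pairs G p q x "y \<otimes> inv x" u v
  proof (rule change_generators)
    show "(y \<otimes> inv x) [^] p = \<one>"
      using xy[of "int p"] pow by (simp add: int_pow_int int_pow_neg)
    show "{x, y, u, v} \<subseteq> generate G {x, y \<otimes> inv x, u, v}"
    proof -
      have "(y \<otimes> inv x) \<otimes> x \<in> generate G {x, y \<otimes> inv x, u, v}"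
        by (rule generate.eng) (auto intro: generate.incl)
      then show ?thesis
        by (auto simp: m_assoc intro: generate.incl)
    qed
  qed (use pow comm comm' in auto)
  have EX: "E.X (a, b) = X (a - b, b)" for a b
    using int_pow_mult[of x a "- b"] by (simp add: xy m_assoc)
  show ?thesis
  proof (rule E.iso_semidirect)
    show "xi_act p g \<in> hom (cyc2 q) (AutoGroup (cyc2 p))"
      using p0 q0 assms(5) by (intro xi_act_hom) auto
    fix k h assume "k \<in> carrier (cyc2 q)" "h \<in> carrier (cyc2 p)"
    then obtain a b c d where [simp]: "k = (c, d)" "h = (a, b)" and
      h: "(a, b) \<in> carrier (cyc2 p)" and k: "0 \<le> c" "0 \<le> d"
      using q0 by (auto simp: carrier_integer_mod_group)
    let ?a = "int g ^ nat c * a + (1 - int g ^ nat c) * b"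
    \<comment> \<open>In the eigenbasis the coordinates are \<open>a - b\<close> and
      \<open>b\<close>; \<open>u\<close> scales only the first, and adding \<open>b\<close> back
      gives the formula of \<open>xi_act\<close>.\<close>
    have "U k \<otimes> E.X h = U (c, d) \<otimes> X (a - b, b)"
      unfolding \<open>k = (c, d)\<close> \<open>h = (a, b)\<close> EX ..
    also have "\<dots> = X (int g ^ nat c * (a - b), b) \<otimes> U k"
      using U_X[of "int g" 1 1 1 c d "a - b" b] assms k by simp
    also have "int g ^ nat c * (a - b) = ?a - b"
      by (simp add: algebra_simps)
    also have "X (?a - b, b) = E.X (?a, b)"
      by (simp only: EX)
    also have "\<dots> = E.X (?a mod int p, b)"
      by (simp add: int_pow_mod pow)
    finally show "U k \<otimes> E.X h = E.X (xi_act p g k h) \<otimes> U k"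
      using h by (simp add: xi_act_def)
  qed
qed

text \<open>Powers coprime to \<open>q\<close> turn any nontrivial eigenvalue into \<open>g\<close>.
  If \<open>i\<close> is 1, then \<open>u\<close> is central and \<open>v\<close> acts by a scalar
  because of \<open>kl\<close>: trivial gives \<open>cyc2\<close>, nontrivial gives theta. Otherwise
  \<open>v\<close> is corrected by a power of \<open>u\<close> so as to commute with
  \<open>x\<close>; its remaining action on \<open>y\<close> decides between xi and psi.\<close>

lemma iso_diagonal:
  fixes g :: nat and i k l :: int
  assumes primes: "Factorial_Ring.prime p" "Factorial_Ring.prime q" "q < p"
    and ux: "u \<otimes> x = x [^] i \<otimes> u" and uy: "u \<otimes> y = y \<otimes> u"
    and vx: "v \<otimes> x = x [^] k \<otimes> v" and vy: "v \<otimes> y = y [^] l \<otimes> v"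
    and roots: "[i ^ q = 1] (mod int p)" "[k ^ q = 1] (mod int p)" "[l ^ q = 1] (mod int p)"
    and kl: "[i = 1] (mod int p) \<Longrightarrow> [k = l] (mod int p)"
    and g: "[p = 1] (mod q) \<Longrightarrow> Pocklington.ord p g = q"
  shows "G \<cong> cyc2 (p * q) \<or>
    ([p = 1] (mod q) \<and>
      (G \<cong> semidirect (cyc2 p) (cyc2 q) (theta_act p g) \<or>
       G \<cong> semidirect (cyc2 p) (cyc2 q) (psi_act p g) \<or>
       G \<cong> semidirect (cyc2 p) (cyc2 q) (xi_act p g)))"
proof -
  note xc = int_pow_cong[OF carr(1) pow(1)] and yc = int_pow_cong[OF carr(2) pow(2)]
  have g_root: "[int g ^ q = 1] (mod int p)" "\<not> [int g = 1] (mod int p)" if "[p = 1] (mod q)"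
  proof -
    have "[g ^ q = 1] (mod p)"
      using g[OF that] by (simp only: ord_divides dvd_refl)
    then show "[int g ^ q = 1] (mod int p)"
      by (simp flip: cong_int_iff)
    show "\<not> [int g = 1] (mod int p)"
    proof
      assume "[int g = 1] (mod int p)"
      then have "[g ^ 1 = 1] (mod p)"
        by (simp flip: cong_int_iff)
      then have "q dvd 1"
        using g[OF that] by (simp only: ord_divides)
      then show False
        using q0 by simp
    qed
  qed
  \<comment> \<open>If \<open>q\<close> divided \<open>n\<close>, then \<open>s ^ n\<close> would be
    1 modulo \<open>p\<close>, unlike \<open>g\<close>. Coprimality ensures that the
    \<open>n\<close>-th power of a generator can replace it.\<close>
  have to_g: "\<exists>n :: nat. [s ^ n = int g] (mod int p) \<and> coprime n q"
    if s: "[s ^ q = 1] (mod int p)" "\<not> [s = 1] (mod int p)" for s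
  proof -
    have p1: "[p = 1] (mod q)"
      using cong_1_of_root_of_unity[OF primes(1,2) s] .
    obtain n where n: "[s ^ n = int g] (mod int p)"
      using root_of_unity_is_power[OF primes(1,2) s g_root(1)[OF p1]] .
    have "\<not> q dvd n"
    proof
      assume "q dvd n"
      then obtain m where "n = q * m" ..
      then have "[s ^ n = 1] (mod int p)"
        using cong_pow[OF s(1), of m] by (simp add: power_mult)
      then show False
        using g_root(2)[OF p1] n cong_sym cong_trans by blast
    qed
    then have "coprime n q"
      using prime_imp_coprime[OF primes(2)] coprime_commute by blast
    with n show ?thesis
      by blast
  qed
  show ?thesis
  proof (cases "[i = 1] (mod int p)")
    case True
    then have ux': "u \<otimes> x = x \<otimes> u"
      using ux xc[of i 1] by simp
    have kl': "[k = l] (mod int p)"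
      using kl True .
    show ?thesis
    proof (cases "[k = 1] (mod int p)")
      case True
      then have "[l = 1] (mod int p)"
        using kl' cong_sym cong_trans by blast
      moreover have "coprime p q"
        using primes by (simp add: primes_coprime)
      ultimately have "G \<cong> cyc2 (p * q)"
        using True ux' uy vx vy xc[of k 1] yc[of l 1] by (intro iso_cyc2) simp_all
      then show ?thesis ..
    next
      case False
      then have p1: "[p = 1] (mod q)"
        using cong_1_of_root_of_unity primes roots by blast
      obtain n where n: "[k ^ n = int g] (mod int p)" "coprime n q"
        using to_g[OF roots(2) False] by blast
      have "[l ^ n = int g] (mod int p)"
        using cong_pow[OF kl', of n] n(1) cong_sym cong_trans by blast
      then have "v [^] n \<otimes> x = x [^] int g \<otimes> v [^] n" "v [^] n \<otimes> y = y [^] int g \<otimes> v [^] n"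
        using twist_nat_pow[OF _ _ vx, of n 1] twist_nat_pow[OF _ _ vy, of n 1]
          xc[OF n(1)] yc[of "l ^ n" "int g"] by simp_all
      then have "G \<cong> semidirect (cyc2 p) (cyc2 q) (theta_act p g)"
        using commuting_pairs.iso_theta[OF power_v[OF n(2)] ux' uy] g[OF p1] by blast
      then show ?thesis
        using p1 by blast
    qed
  next
    case False
    then have p1: "[p = 1] (mod q)"
      using cong_1_of_root_of_unity primes roots by blast
    obtain n where n: "[i ^ n = int g] (mod int p)" "coprime n q"
      using to_g[OF roots(1) False] by blast
    \<comment> \<open>Modulo \<open>p\<close>, \<open>k ^ (q - 1)\<close> is the inverse of
      \<open>k\<close>. As a root of unity it equals some \<open>i ^ f\<close>, so
      \<open>v \<otimes> u [^] f\<close> commutes with \<open>x\<close>.\<close>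
    have "[(k ^ (q - 1)) ^ q = 1] (mod int p)"
      using cong_pow[OF roots(2), of "q - 1"] by (simp add: mult.commute flip: power_mult)
    then obtain f where f: "[i ^ f = k ^ (q - 1)] (mod int p)"
      using root_of_unity_is_power[OF primes(1,2) roots(1) False] by blast
    have "[k * i ^ f = k * k ^ (q - 1)] (mod int p)"
      using f by (rule cong_scalar_left)
    moreover have "k * k ^ (q - 1) = k ^ q"
      using q0 by (simp add: power_eq_if)
    ultimately have kf: "[k * i ^ f = 1] (mod int p)"
      using roots(2) cong_trans by simp
    define w where "w = v \<otimes> u [^] f"
    have w: "w \<in> carrier G"
      by (simp add: w_def)
    have uv: "u [^] f \<otimes> v = v \<otimes> u [^] f"
      using group_commutes_pow[OF comm(2)] by simp
    interpret W: commuting_pairs G p q x y u w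
    proof (rule change_generators)
      have "(u [^] f) [^] q = \<one>"
        using pow by (metis carr(3) nat_pow_one nat_pow_pow mult.commute)
      then show "w [^] q = \<one>"
        using pow uv by (simp add: w_def pow_mult_distrib)
      have "u \<otimes> u [^] f = u [^] f \<otimes> u"
        by (simp add: group_commutes_pow)
      moreover have "u \<otimes> w = (u \<otimes> v) \<otimes> u [^] f"
        by (simp add: w_def m_assoc)
      ultimately show "u \<otimes> w = w \<otimes> u"
        by (simp add: w_def comm m_assoc)
      have inc: "u \<in> generate G {x, y, u, w}" "w \<in> generate G {x, y, u, w}"
        by (auto intro: generate.incl)
      have sub: "subgroup (generate G {x, y, u, w}) G"
        using w by (intro generate_is_subgroup) auto
      have "w \<otimes> inv (u [^] f) \<in> generate G {x, y, u, w}"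
        using inc subgroup_int_pow_closed[OF sub inc(1), of "int f"] sub
        by (simp add: int_pow_int subgroup.m_closed subgroup.m_inv_closed)
      moreover have "w \<otimes> inv (u [^] f) = v"
        by (simp add: w_def m_assoc)
      ultimately show "{x, y, u, v} \<subseteq> generate G {x, y, u, w}"
        by (auto intro: generate.incl)
    qed (use pow comm w in auto)
    have "w \<otimes> x = v \<otimes> (u [^] f \<otimes> x [^] (1 :: int))"
      by (simp add: w_def m_assoc)
    also have "\<dots> = (v \<otimes> x [^] (i ^ f)) \<otimes> u [^] f"
      using twist_nat_pow[OF _ _ ux, of f 1] by (simp add: m_assoc)
    also have "v \<otimes> x [^] (i ^ f) = x [^] (k * i ^ f) \<otimes> v"
      using twist_nat_pow[OF _ _ vx, of 1 "i ^ f"] by simp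
    also have "x [^] (k * i ^ f) = x"
      using xc[OF kf] by simp
    finally have wx: "w \<otimes> x = x \<otimes> w"
      by (simp add: w_def m_assoc)
    have "u [^] f \<otimes> y = y \<otimes> u [^] f"
      using group_commutes_pow[OF uy] by simp
    then have "w \<otimes> y = (v \<otimes> y) \<otimes> u [^] f"
      by (simp add: w_def m_assoc)
    then have wy: "w \<otimes> y = y [^] l \<otimes> w"
      by (simp add: w_def m_assoc vy)
    interpret E: commuting_pairs G p q x y "u [^] n" w
      using n(2) by (rule W.power_u)
    have ux': "u [^] n \<otimes> x = x [^] int g \<otimes> u [^] n"
      using twist_nat_pow[OF _ _ ux, of n 1] xc[OF n(1)] by simp
    have uy': "u [^] n \<otimes> y = y \<otimes> u [^] n"
      using group_commutes_pow[OF uy] by simp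
    show ?thesis
    proof (cases "[l = 1] (mod int p)")
      case True
      then have "w \<otimes> y = y \<otimes> w"
        using wy yc[of l 1] by simp
      then have "G \<cong> semidirect (cyc2 p) (cyc2 q) (xi_act p g)"
        using E.iso_xi[OF ux' uy' wx] g[OF p1] by blast
      then show ?thesis
        using p1 by blast
    next
      case False
      obtain m where m: "[l ^ m = int g] (mod int p)" "coprime m q"
        using to_g[OF roots(3) False] by blast
      have "w [^] m \<otimes> x = x \<otimes> w [^] m"
        using group_commutes_pow[OF wx] w by simp
      moreover have "w [^] m \<otimes> y = y [^] int g \<otimes> w [^] m"
        using twist_nat_pow[OF _ _ wy, of m 1] yc[OF m(1)] w by simp
      ultimately have "G \<cong> semidirect (cyc2 p) (cyc2 q) (psi_act p g)"
        using commuting_pairs.iso_psi[OF E.power_v[OF m(2)] ux' uy'] g[OF p1] by blast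
      then show ?thesis
        using p1 by blast
    qed
  qed
qed

text \<open>Replacing \<open>y\<close> by a suitable \<open>x\<^sup>j y\<close> diagonalizes the action of \<open>u\<close>; the action of \<open>v\<close> stays
  diagonal because \<open>v\<close> commutes with \<open>u\<close>.\<close>

lemma iso_triangular:
  fixes g :: nat and i k l c :: int
  assumes primes: "Factorial_Ring.prime p" "Factorial_Ring.prime q" "q < p"
    and nontriv: "x \<noteq> \<one>" "y \<noteq> \<one>"
    and ux: "u \<otimes> x = x [^] i \<otimes> u" and uy: "u \<otimes> y = x [^] c \<otimes> y \<otimes> u"
    and vx: "v \<otimes> x = x [^] k \<otimes> v" and vy: "v \<otimes> y = y [^] l \<otimes> v"
    and kl: "[i = 1] (mod int p) \<Longrightarrow> [k = l] (mod int p)"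
    and g: "[p = 1] (mod q) \<Longrightarrow> Pocklington.ord p g = q"
  shows "G \<cong> cyc2 (p * q) \<or>
    ([p = 1] (mod q) \<and>
      (G \<cong> semidirect (cyc2 p) (cyc2 q) (theta_act p g) \<or>
       G \<cong> semidirect (cyc2 p) (cyc2 q) (psi_act p g) \<or>
       G \<cong> semidirect (cyc2 p) (cyc2 q) (xi_act p g)))"
proof -
  have eq_iff: "z [^] a = z [^] b \<longleftrightarrow> [a = b] (mod int p)"
    if "z \<in> carrier G" "z [^] p = \<one>" "z \<noteq> \<one>" for z and a b :: int
    using that primes by (simp add: int_pow_eq ord_prime_eq cong_iff_dvd_diff dvd_diff_commute)
  note x_iff = eq_iff[OF carr(1) pow(1) nontriv(1)] and y_iff = eq_iff[OF carr(2) pow(2) nontriv(2)]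
  \<comment> \<open>Since \<open>u [^] q\<close> and \<open>v [^] q\<close> are trivial, acting
    \<open>q\<close> times does nothing.\<close>
  have "x [^] (i ^ q) = x" "x [^] (k ^ q) = x" "y [^] (l ^ q) = y"
    using twist_nat_pow[OF _ _ ux, of q 1] twist_nat_pow[OF _ _ vx, of q 1]
      twist_nat_pow[OF _ _ vy, of q 1] pow by simp_all
  then have roots: "[i ^ q = 1] (mod int p)" "[k ^ q = 1] (mod int p)" "[l ^ q = 1] (mod int p)"
    using x_iff[of _ 1] y_iff[of _ 1] by simp_all
  have xy: "y [^] b \<otimes> x [^] a = x [^] a \<otimes> y [^] b" for a b :: int
    using twist_int_pow[of "y [^] b" x x a] twist_int_pow[of x y y b] comm by simp
  \<comment> \<open>For \<open>z = x [^] j \<otimes> y\<close>, the first congruence makes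
    \<open>u\<close> commute with \<open>z\<close>, the second keeps \<open>z\<close> an eigenvector
    of \<open>v\<close>.\<close>
  have "\<exists>j. [i * j + c = j] (mod int p) \<and> [k * j = l * j] (mod int p)"
  proof (cases "[i = 1] (mod int p)")
    case True
    have ux': "u \<otimes> x = x \<otimes> u"
      using ux True x_iff[of i 1] by simp
    \<comment> \<open>Conjugating \<open>u\<close> by \<open>y\<close> gives
      \<open>x [^] (- c) \<otimes> u\<close>, whose \<open>q\<close>-th power is therefore trivial
      too. As \<open>u\<close> commutes with \<open>x\<close>, this forces \<open>p\<close> to
      divide \<open>c\<close>, and \<open>j = 0\<close> works.\<close>
    have "y \<otimes> u = (x [^] (- c) \<otimes> u) \<otimes> y"
    proof -
      have "y \<otimes> u = x [^] (- c) \<otimes> (x [^] c \<otimes> y \<otimes> u)"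
        by (simp add: m_assoc int_pow_neg flip: m_assoc[of "inv (x [^] c)"])
      then show ?thesis
        by (simp add: m_assoc flip: uy)
    qed
    then have "y \<otimes> u [^] int q = (x [^] (- c) \<otimes> u) [^] int q \<otimes> y"
      by (intro twist_int_pow) simp_all
    then have "(x [^] (- c) \<otimes> u) [^] q = \<one>"
      using pow by (simp add: int_pow_int)
    moreover have "x [^] (- c) \<otimes> u = u \<otimes> x [^] (- c)"
      using twist_int_pow[OF _ _ _ ux'] by simp
    ultimately have "(x [^] (- c)) [^] q = \<one>"
      using pow by (simp add: pow_mult_distrib)
    moreover have "x [^] (- c * int q) = (x [^] (- c)) [^] q"
      by (subst int_pow_pow[symmetric]) (simp_all add: int_pow_int)
    ultimately have "x [^] (- c * int q) = x [^] (0 :: int)"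
      by simp
    then have "int p dvd c * int q"
      unfolding x_iff by (simp add: cong_0_iff)
    moreover have "coprime (int p) (int q)"
      using primes by (simp add: primes_coprime)
    ultimately have "int p dvd c"
      using coprime_dvd_mult_left_iff by blast
    then show ?thesis
      by (intro exI[of _ 0]) (simp add: cong_0_iff)
  next
    case False
    \<comment> \<open>Here \<open>i - 1\<close> is invertible modulo \<open>p\<close>, and
      \<open>j\<close> is its inverse times \<open>- c\<close>.\<close>
    have "coprime (i - 1) (int p)"
      using False primes(1) by (simp add: cong_iff_dvd_diff coprime_commute prime_imp_coprime)
    then obtain j' where "[(i - 1) * j' = 1] (mod int p)"
      using cong_solve_coprime_int by blast
    then have "[(i - 1) * j' * (- c) = 1 * (- c)] (mod int p)"
      by (rule cong_scalar_right)
    then have "int p dvd (i - 1) * (- (j' * c)) + c"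
      by (simp add: cong_iff_dvd_diff mult.assoc)
    then obtain j where j: "int p dvd (i - 1) * j + c" ..
    \<comment> \<open>Moving \<open>u \<otimes> v\<close> past \<open>y\<close> in both orders gives
      \<open>(k - l) * c = 0\<close> modulo \<open>p\<close>; cancelling \<open>i - 1\<close> turns
      this into \<open>(k - l) * j = 0\<close>.\<close>
    have "x [^] (c * l) = x [^] (k * c)"
    proof -
      have "u \<otimes> (v \<otimes> y) = (u \<otimes> y [^] l) \<otimes> v"
        by (simp add: vy m_assoc)
      also have "u \<otimes> y [^] l = (x [^] c \<otimes> y) [^] l \<otimes> u"
        using uy by (intro twist_int_pow) simp_all
      also have "(x [^] c \<otimes> y) [^] l = x [^] (c * l) \<otimes> y [^] l"
        using xy[of 1 c] by (simp add: int_pow_mult_distrib int_pow_pow)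
      finally have 1: "u \<otimes> (v \<otimes> y) = x [^] (c * l) \<otimes> (y [^] l \<otimes> (u \<otimes> v))"
        by (simp add: m_assoc)
      have "v \<otimes> (u \<otimes> y) = (v \<otimes> x [^] c) \<otimes> (y \<otimes> u)"
        by (simp add: uy m_assoc)
      also have "v \<otimes> x [^] c = x [^] (k * c) \<otimes> v"
        using twist_nat_pow[OF _ _ vx, of 1 c] by simp
      also have "x [^] (k * c) \<otimes> v \<otimes> (y \<otimes> u) = x [^] (k * c) \<otimes> ((v \<otimes> y) \<otimes> u)"
        by (simp add: m_assoc)
      finally have 2: "v \<otimes> (u \<otimes> y) = x [^] (k * c) \<otimes> (y [^] l \<otimes> (u \<otimes> v))"
        by (simp add: vy m_assoc comm)
      have "u \<otimes> (v \<otimes> y) = v \<otimes> (u \<otimes> y)"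
        using comm by (simp flip: m_assoc)
      then show ?thesis
        unfolding 1 2 by simp
    qed
    then have "int p dvd (k - l) * c"
      by (simp add: x_iff cong_iff_dvd_diff algebra_simps dvd_diff_commute)
    moreover have "(i - 1) * ((k - l) * j) = (k - l) * ((i - 1) * j + c) - (k - l) * c"
      by (simp add: algebra_simps)
    ultimately have "int p dvd (i - 1) * ((k - l) * j)"
      using j by (simp add: dvd_diff dvd_mult)
    then have "int p dvd (k - l) * j"
      using \<open>coprime (i - 1) (int p)\<close> coprime_commute coprime_dvd_mult_right_iff by blast
    with j show ?thesis
      by (intro exI[of _ j]) (simp add: cong_iff_dvd_diff algebra_simps)
  qed
  then obtain j where j: "[i * j + c = j] (mod int p)" "[k * j = l * j] (mod int p)"
    by blast
  define z where "z = x [^] j \<otimes> y"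
  have z: "z \<in> carrier G"
    by (simp add: z_def)
  interpret Z: commuting_pairs G p q x z u v
  proof (rule change_generators)
    have "(x [^] j) [^] p = \<one>"
      using pow(1) by (metis carr(1) int_pow_int int_pow_one int_pow_pow mult.commute)
    then show "z [^] p = \<one>"
      using pow xy[of 1 j] by (simp add: z_def pow_mult_distrib)
    have "x \<otimes> x [^] j = x [^] j \<otimes> x"
      using int_pow_mult[of x 1 j] int_pow_mult[of x j 1] by (simp add: add.commute)
    then show "x \<otimes> z = z \<otimes> x"
      using comm by (simp add: z_def m_assoc flip: comm(1)) (simp flip: m_assoc)
    have inc: "x \<in> generate G {x, z, u, v}" "z \<in> generate G {x, z, u, v}"
      by (auto intro: generate.incl)
    have sub: "subgroup (generate G {x, z, u, v}) G"
      using z by (intro generate_is_subgroup) auto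
    have "inv (x [^] j) \<otimes> z \<in> generate G {x, z, u, v}"
      using inc subgroup_int_pow_closed[OF sub inc(1), of j] sub
      by (simp add: subgroup.m_closed subgroup.m_inv_closed)
    moreover have "inv (x [^] j) \<otimes> z = y"
      by (simp add: z_def flip: m_assoc)
    ultimately show "{x, y, u, v} \<subseteq> generate G {x, z, u, v}"
      by (auto intro: generate.incl)
  qed (use pow comm z in auto)
  have "u \<otimes> z = (u \<otimes> x [^] j) \<otimes> y"
    by (simp add: z_def m_assoc)
  also have "u \<otimes> x [^] j = x [^] (i * j) \<otimes> u"
    using twist_nat_pow[OF _ _ ux, of 1 j] by simp
  also have "x [^] (i * j) \<otimes> u \<otimes> y = x [^] (i * j + c) \<otimes> (y \<otimes> u)"
    by (simp add: m_assoc uy int_pow_mult)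
  also have "x [^] (i * j + c) = x [^] j"
    using j by (simp add: x_iff)
  finally have uz: "u \<otimes> z = z \<otimes> u"
    by (simp add: z_def m_assoc)
  have "v \<otimes> z = (v \<otimes> x [^] j) \<otimes> y"
    by (simp add: z_def m_assoc)
  also have "v \<otimes> x [^] j = x [^] (k * j) \<otimes> v"
    using twist_nat_pow[OF _ _ vx, of 1 j] by simp
  also have "x [^] (k * j) = x [^] (j * l)"
    using j by (simp add: x_iff mult.commute)
  also have "x [^] (j * l) \<otimes> v \<otimes> y = x [^] (j * l) \<otimes> y [^] l \<otimes> v"
    by (simp add: m_assoc vy)
  also have "x [^] (j * l) \<otimes> y [^] l = z [^] l"
    using xy[of 1 j] by (simp add: z_def int_pow_mult_distrib int_pow_pow)
  finally have vz: "v \<otimes> z = z [^] l \<otimes> v" .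
  show ?thesis
    using Z.iso_diagonal[OF primes ux uz vx vz roots kl g] .
qed

end

section \<open>Automorphisms of prime order\<close>

lemma funpow_mult_fixed:
  assumes "(f ^^ n) x = x"
  shows "(f ^^ (n * m)) x = x"
proof (induction m)
  case (Suc m)
  then show ?case
    using assms by (simp add: funpow_add)
qed simp

text \<open>By Bezout some multiple of \<open>m\<close> exceeds a multiple of \<open>n\<close> by
  exactly one, leaving a single application of \<open>f\<close>.\<close>

lemma funpow_coprime_fixed:
  assumes "(f ^^ m) x = x" "(f ^^ n) x = x" "coprime m n" "m \<noteq> 0"
  shows "f x = x"
proof -
  obtain a b where "m * a = n * b + 1"
    using bezout_nat[OF assms(4), of n] assms(3) by auto
  then have "(f ^^ (n * b + 1)) x = x"
    using funpow_mult_fixed[OF assms(1), of a] by simp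
  then have "f ((f ^^ (n * b)) x) = x"
    by simp
  then show ?thesis
    by (simp only: funpow_mult_fixed[OF assms(2)])
qed

text \<open>All orbits outside the fixed points have size \<open>r\<close>.\<close>

lemma prime_dvd_card_nonfixed:
  assumes "finite X" "f ` X \<subseteq> X" "\<And>x. x \<in> X \<Longrightarrow> (f ^^ r) x = x" "Factorial_Ring.prime (r :: nat)"
  shows "r dvd card {x \<in> X. f x \<noteq> x}"
  using assms(1-3)
proof (induction rule: finite_psubset_induct)
  case (psubset X)
  have r0: "0 < r"
    using assms(4) prime_gt_0_nat by blast
  have iter: "(f ^^ n) x \<in> X" if "x \<in> X" for x n
    using that psubset.prems(1) by (induction n) auto
  show ?case
  proof (cases "\<exists>x\<in>X. f x \<noteq> x")
    case False
    then have "{x \<in> X. f x \<noteq> x} = {}"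
      by blast
    then show ?thesis
      by (metis card.empty dvd_0_right)
  next
    case True
    then obtain x where x: "x \<in> X" "f x \<noteq> x"
      by blast
    have fr: "(f ^^ r) x = x"
      using psubset.prems(2) x by blast
    define orb where "orb = (\<lambda>n. (f ^^ n) x) ` {..<r}"
    \<comment> \<open>Such a \<open>d\<close> is coprime to the prime \<open>r\<close>, so a return
      after \<open>d\<close> steps would make \<open>x\<close> a fixed point.\<close>
    have neq: "(f ^^ d) x \<noteq> x" if "0 < d" "d < r" for d
      using funpow_coprime_fixed[where f = f and m = d and n = r and x = x] that fr x(2) prime_imp_coprime[OF assms(4), of d]
      by (auto simp: coprime_commute nat_dvd_not_less)
    have inj: "inj_on (\<lambda>n. (f ^^ n) x) {..<r}"
    proof (rule linorder_inj_onI')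
      fix m n assume mn: "m \<in> {..<r}" "n \<in> {..<r}" "m < n"
      show "(f ^^ m) x \<noteq> (f ^^ n) x"
      proof
        assume "(f ^^ m) x = (f ^^ n) x"
        then have "(f ^^ (r - n)) ((f ^^ m) x) = (f ^^ (r - n)) ((f ^^ n) x)"
          by simp
        then have "(f ^^ (r - n + m)) x = (f ^^ (r - n + n)) x"
          by (simp only: funpow_add comp_apply)
        then have "(f ^^ (r - n + m)) x = x"
          using mn fr by simp
        moreover have "0 < r - n + m" "r - n + m < r"
          using mn unfolding lessThan_iff by linarith+
        ultimately show False
          using neq[of "r - n + m"] by (simp only:)
      qed
    qed
    have orb_X: "orb \<subseteq> X"
      using iter x by (auto simp: orb_def)
    have f_orb: "f z \<in> orb" if z: "z \<in> orb" for z
    proof -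
      obtain n where n: "n < r" "z = (f ^^ n) x"
        using z by (auto simp: orb_def)
      show ?thesis
      proof (cases "Suc n = r")
        case True
        then have "f z = (f ^^ 0) x"
          using fr n by (metis funpow.simps(2) comp_apply funpow_0)
        then show ?thesis
          unfolding orb_def using r0 by blast
      next
        case False
        then have "Suc n < r" "f z = (f ^^ Suc n) x"
          using n by simp_all
        then show ?thesis
          unfolding orb_def by blast
      qed
    qed
    have "(f ^^ n) z \<in> orb" if "z \<in> orb" for z n
      using that f_orb by (induction n) auto
    \<comment> \<open>The remaining \<open>r - 1\<close> steps lead from \<open>f z\<close> back to
      \<open>z\<close>. Hence \<open>X - orb\<close> is mapped into itself and the induction
      hypothesis applies to it.\<close>
    then have orb_back: "z \<in> orb" if "f z \<in> orb" "z \<in> X" for z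
      using psubset.prems(2)[OF that(2)] that(1) r0
      by (metis Suc_pred comp_apply funpow_Suc_right)
    have "r dvd card {z \<in> X - orb. f z \<noteq> z}"
      using x orb_X r0 psubset.prems orb_back
      by (intro psubset.IH) (auto simp: orb_def intro: image_eqI[of _ _ 0])
    moreover have "card orb = r"
      using inj by (simp add: orb_def card_image)
    \<comment> \<open>Going round the orbit from a fixed \<open>z\<close> reaches \<open>x\<close>,
      which would then equal \<open>z\<close> and be fixed.\<close>
    moreover have "f z \<noteq> z" if z: "z \<in> orb" for z
    proof
      assume fz: "f z = z"
      obtain n where n: "n < r" "z = (f ^^ n) x"
        using z by (auto simp: orb_def)
      have "(f ^^ m) z = z" for m
        using fz by (induction m) auto
      moreover have "(f ^^ (r - n)) z = (f ^^ (r - n + n)) x"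
        by (simp only: n funpow_add comp_apply)
      moreover have "r - n + n = r"
        using n by simp
      ultimately show False
        using fr fz x(2) by simp
    qed
    then have "{z \<in> X. f z \<noteq> z} = {z \<in> X - orb. f z \<noteq> z} \<union> orb"
      using orb_X by blast
    then have "card {z \<in> X. f z \<noteq> z} = card {z \<in> X - orb. f z \<noteq> z} + card orb"
      using psubset.hyps by (simp only:) (rule card_Un_disjoint, auto intro: finite_subset[OF orb_X])
    ultimately show ?thesis
      by simp
  qed
qed

section \<open>Cauchy's theorem and fixed points of endomorphisms\<close>

context group
begin

lemma pow_card_subgroup:
  assumes "subgroup H G" "x \<in> H"
  shows "x [^] card H = \<one>"
proof -
  interpret H: group "G\<lparr>carrier := H\<rparr>"
    using assms(1) subgroup.subgroup_is_group is_group by blast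
  show ?thesis
    using H.pow_order_eq_1[of x] assms(2) by (simp add: order_def nat_pow_consistent[symmetric])
qed

text \<open>Sylow's theorem with exponent 1 gives a subgroup of order \<open>r\<close>; any
  nontrivial element of it will do.\<close>

lemma cauchy_subgroup:
  assumes "subgroup H G" "finite H" "Factorial_Ring.prime r" "r dvd card H"
  obtains x where "x \<in> H" "ord x = r"
proof -
  interpret H: group "G\<lparr>carrier := H\<rparr>"
    using assms(1) subgroup.subgroup_is_group is_group by blast
  obtain m where "card H = r ^ 1 * m"
    using assms(4) by auto
  then obtain K where K: "subgroup K (G\<lparr>carrier := H\<rparr>)" "card K = r ^ 1"
    using sylow_thm[OF assms(3) H.group_axioms, of 1 m] assms(2) by (auto simp: order_def)
  have "1 < card K"
    using K prime_gt_1_nat[OF assms(3)] by simp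
  then obtain x where x: "x \<in> K" "x \<noteq> \<one>"
    by (metis card_1_singleton_iff card_mono finite.emptyI finite_insert linorder_not_less
        One_nat_def singletonI subsetI is_singletonI is_singleton_altdef)
  have "x \<in> H" "subgroup K G"
    using K x subgroup.subset[OF K(1)] incl_subgroup[OF assms(1)] by auto
  moreover have "x \<in> carrier G"
    using calculation(1) subgroup.subset[OF assms(1)] by blast
  ultimately show thesis
    using that ord_prime_eq[of x r] pow_card_subgroup[of K x] x K assms(3) by simp
qed

lemma subgroup_fixed_points:
  assumes "f \<in> hom G G"
  shows "subgroup {z \<in> carrier G. f z = z} G"
proof -
  interpret f: group_hom G G f
    using assms by unfold_locales
  show ?thesis
    by (rule subgroupI) (auto intro: exI[of _ \<one>])
qed

text \<open>The moved points number a multiple of \<open>r\<close>, hence so do the fixed points.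
  These form a subgroup, to which Cauchy's theorem applies.\<close>

lemma fixed_point_of_prime_order:
  assumes "f \<in> hom G G" "finite (carrier G)" "Factorial_Ring.prime r" "r dvd order G"
    and "\<And>z. z \<in> carrier G \<Longrightarrow> (f ^^ r) z = z"
  obtains x where "x \<in> carrier G" "ord x = r" "f x = x"
proof -
  let ?F = "{z \<in> carrier G. f z = z}" and ?N = "{z \<in> carrier G. f z \<noteq> z}"
  have "r dvd card ?N"
    using assms by (intro prime_dvd_card_nonfixed) (auto simp: hom_def)
  moreover have "carrier G = ?F \<union> ?N"
    by blast
  then have "order G = card ?F + card ?N"
    unfolding order_def using assms(2) by (metis (no_types, lifting) card_Un_disjoint disjoint_iff finite_Un mem_Collect_eq)
  ultimately have "r dvd card ?F"
    using assms(4) by (simp add: dvd_add_left_iff)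
  then obtain x where "x \<in> ?F" "ord x = r"
    using cauchy_subgroup[OF subgroup_fixed_points[OF assms(1)]] assms(2,3) by auto
  then show thesis
    using that by blast
qed

end

section \<open>Groups of order pq\<close>

locale group_order_pq = group G for G (structure) +
  fixes p q :: nat
  assumes p: "Factorial_Ring.prime p" and q: "Factorial_Ring.prime q" and qp: "q < p"
    and order: "order G = p * q"
begin

lemma pos: "0 < p" "0 < q"
  using p q by (auto intro: prime_gt_0_nat)

lemma finite_carrier: "finite (carrier G)"
  using order pos order_gt_0_iff_finite by simp

text \<open>This is uniqueness of the subgroup of order \<open>p\<close>: otherwise the products
  \<open>x [^] i \<otimes> z [^] j\<close> would be \<open>p * p\<close> distinct elements, more
  than the group has.\<close>

lemma powers_of_order_p:
  assumes x: "x \<in> carrier G" "ord x = p" and z: "z \<in> carrier G" "z [^] p = \<one>"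
  obtains n :: int where "z = x [^] n"
proof -
  have "\<exists>n :: int. z = x [^] n"
  proof (rule ccontr)
    assume no: "\<nexists>n :: int. z = x [^] n"
    let ?I = "{0..<int p}" and ?f = "\<lambda>(i :: int, j :: int). x [^] i \<otimes> z [^] j"
    have "inj_on ?f (?I \<times> ?I)"
    proof (rule inj_onI, clarify)
      fix i j i' j' assume ij: "i \<in> ?I" "i' \<in> ?I" "j \<in> ?I" "j' \<in> ?I"
        and eq: "x [^] i \<otimes> z [^] j = x [^] i' \<otimes> z [^] j'"
      have "z [^] (j' - j) = inv (x [^] i') \<otimes> (x [^] i' \<otimes> z [^] j') \<otimes> inv (z [^] j)"
        using x z by (simp add: int_pow_diff) (simp flip: m_assoc)
      also have "\<dots> = inv (x [^] i') \<otimes> (x [^] i \<otimes> z [^] j) \<otimes> inv (z [^] j)"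
        by (simp add: eq)
      also have "\<dots> = x [^] (i - i')"
        using x z int_pow_mult[of x "- i'" i] by (simp add: m_assoc int_pow_neg)
      finally have zx: "z [^] (j' - j) = x [^] (i - i')" .
      \<comment> \<open>If not, \<open>j' - j\<close> is invertible modulo \<open>p\<close>, and
        \<open>z\<close> itself becomes a power of \<open>x\<close>.\<close>
      have "j = j'"
      proof (rule ccontr)
        assume "j \<noteq> j'"
        then have "j' mod int p \<noteq> j mod int p"
          using ij by simp
        then have "\<not> int p dvd j' - j"
          by (simp add: mod_eq_dvd_iff)
        then have "coprime (j' - j) (int p)"
          using p by (simp add: coprime_commute prime_imp_coprime)
        then obtain m where m: "[(j' - j) * m = 1] (mod int p)"
          using cong_solve_coprime_int by blast
        have "z = z [^] ((j' - j) * m)"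
          using int_pow_cong[OF z m] z by simp
        also have "\<dots> = (x [^] (i - i')) [^] m"
          using z by (simp add: zx flip: int_pow_pow)
        also have "\<dots> = x [^] ((i - i') * m)"
          using x by (simp add: int_pow_pow)
        finally show False
          using no by blast
      qed
      moreover from this have "x [^] (i - i') = \<one>"
        using zx x z by simp
      then have "int p dvd i - i'"
        using int_pow_eq_id x by simp
      then have "i mod int p = i' mod int p"
        by (simp add: mod_eq_dvd_iff)
      then have "i = i'"
        using ij by simp
      ultimately show "i = i' \<and> j = j'"
        by simp
    qed
    then have "card (?f ` (?I \<times> ?I)) = p * p"
      by (simp add: card_image card_cartesian_product)
    moreover have "?f ` (?I \<times> ?I) \<subseteq> carrier G"
      using x z by auto
    then have "card (?f ` (?I \<times> ?I)) \<le> p * q"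
      using card_mono[OF finite_carrier] order by (simp add: order_def)
    ultimately show False
      using qp pos by simp
  qed
  then show thesis
    using that by blast
qed

text \<open>By Lagrange both primes divide the order of \<open>H\<close>. Besides generation, this
  serves to show that a homomorphism fixing \<open>x\<close> and \<open>y\<close> is the identity,
  with \<open>H\<close> its fixed points.\<close>

lemma subgroup_eq_carrier:
  assumes "subgroup H G" "x \<in> H" "ord x = p" "y \<in> H" "ord y = q"
  shows "H = carrier G"
proof -
  have H: "H \<subseteq> carrier G"
    using assms(1) subgroup.subset by blast
  have "p dvd card H" "q dvd card H"
    using pow_card_subgroup[OF assms(1)] assms pow_eq_id H by (metis subsetD)+
  moreover have "coprime p q"
    using p q qp by (simp add: primes_coprime)
  ultimately have "order G dvd card H"
    by (simp add: order divides_mult)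
  moreover have "card H dvd order G"
    using lagrange[OF assms(1)] by (metis dvd_triv_right)
  ultimately have "card H = card (carrier G)"
    by (simp add: order_def dvd_antisym)
  then show ?thesis
    using card_subset_eq[OF finite_carrier H] by simp
qed

text \<open>The automorphism permutes the \<open>q\<close> cosets of the subgroup of order \<open>p\<close>, which is too few
  for a nontrivial orbit.\<close>

lemma order_p_automorphism:
  assumes f: "f \<in> hom G G" and fp: "\<And>z. z \<in> carrier G \<Longrightarrow> (f ^^ p) z = z"
    and x: "x \<in> carrier G" "ord x = p" and z: "z \<in> carrier G"
  shows "f x = x" "\<exists>c :: int. f z = x [^] c \<otimes> z"
proof -
  interpret f: group_hom G G f
    using f by unfold_locales
  \<comment> \<open>Since \<open>x\<close> is a power of this fixed element, it is fixed as
    well.\<close>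
  obtain w where w: "w \<in> carrier G" "ord w = p" "f w = w"
    using fixed_point_of_prime_order[OF f finite_carrier p _ fp] order by auto
  have "x [^] p = \<one>"
    using x pow_eq_id by simp
  then obtain n :: int where "x = w [^] n"
    using powers_of_order_p[OF w(1,2) x(1)] by blast
  then show fx: "f x = x"
    using w by (simp add: f.hom_int_pow)
  define P where "P = range (\<lambda>n :: int. x [^] n)"
  have P: "subgroup P G" "card P = p"
    using subgroup_of_powers[OF x(1)] generate_pow_card[OF x(1)] generate_pow[OF x(1)] x(2)
    by (simp_all add: P_def full_SetCompr_eq)
  have PG: "P \<subseteq> carrier G"
    using P(1) subgroup.subset by blast
  have fP: "f h = h" if "h \<in> P" for h
    using that x fx by (auto simp: P_def f.hom_int_pow)
  have im: "f ` (P #> y) = P #> f y" if "y \<in> carrier G" for y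
  proof -
    have "f (h \<otimes> y) = h \<otimes> f y" if "h \<in> P" for h
      using that PG \<open>y \<in> carrier G\<close> fP by auto
    then show ?thesis
      by (force simp: r_coset_def)
  qed
  have iter: "(image f ^^ n) K = (f ^^ n) ` K" for n and K :: "'a set"
    by (induction n) (auto simp: image_comp)
  have card: "card (rcosets P) = q"
    using lagrange[OF P(1)] P(2) order pos by simp
  have fin: "finite (rcosets P)"
    using card pos card.infinite by fastforce
  have "p dvd card {K \<in> rcosets P. f ` K \<noteq> K}"
  proof (rule prime_dvd_card_nonfixed[OF fin])
    show "image f ` (rcosets P) \<subseteq> rcosets P"
      using im f.hom_closed by (fastforce simp: RCOSETS_def)
    fix K assume "K \<in> rcosets P"
    then have "K \<subseteq> carrier G"
      using rcosets_part_G[OF P(1)] by blast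
    then have "(f ^^ p) ` K = K"
      using fp by (force simp: subset_iff)
    then show "(image f ^^ p) K = K"
      by (simp add: iter)
  qed (fact p)
  moreover have "card {K \<in> rcosets P. f ` K \<noteq> K} < p"
    using card_mono[OF fin, of "{K \<in> rcosets P. f ` K \<noteq> K}"] card qp by auto
  ultimately have "card {K \<in> rcosets P. f ` K \<noteq> K} = 0"
    by (meson nat_dvd_not_less not_gr_zero)
  then have "{K \<in> rcosets P. f ` K \<noteq> K} = {}"
    using fin by simp
  moreover have "P #> z \<in> rcosets P"
    using PG z by (rule rcosetsI)
  ultimately have "f ` (P #> z) = P #> z"
    by blast
  moreover have "z \<in> P #> z"
    using z P(1) by (rule rcos_self)
  ultimately have "f z \<in> P #> z"
    by blast
  then show "\<exists>c :: int. f z = x [^] c \<otimes> z"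
    by (auto simp: r_coset_def P_def)
qed

lemma normalizes_order_p:
  assumes "x \<in> carrier G" "ord x = p" "u \<in> carrier G"
  obtains i :: int where "u \<otimes> x = x [^] i \<otimes> u"
proof -
  have "(u \<otimes> x \<otimes> inv u) [^] p = u \<otimes> x [^] p \<otimes> inv u"
    using hom_nat_pow[OF conjugation_hom[OF assms(3)] assms(1)] group_axioms by simp
  also have "\<dots> = \<one>"
    using assms pow_ord_eq_1[of x] by simp
  finally obtain i :: int where "u \<otimes> x \<otimes> inv u = x [^] i"
    using powers_of_order_p[OF assms(1,2), of "u \<otimes> x \<otimes> inv u"] assms by auto
  then have "u \<otimes> x = x [^] i \<otimes> u"
    using assms by (metis inv_solve_right' int_pow_closed m_closed)
  then show thesis
    by (rule that)
qed

end

section \<open>Skew left braces of order \<open>pq\<close>\<close>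

lemma carrier_semidirect [simp]: "carrier (semidirect H G \<psi>) = carrier H \<times> carrier G"
  by (simp add: semidirect_def)

lemma mult_semidirect [simp]:
  "(h1, g1) \<otimes>\<^bsub>semidirect H G \<psi>\<^esub> (h2, g2) = (h1 \<otimes>\<^bsub>H\<^esub> \<psi> g1 h2, g1 \<otimes>\<^bsub>G\<^esub> g2)"
  by (simp add: semidirect_def)

section \<open>The lambda map as an action, and the two embeddings into the semidirect
  product\<close>

context skew_left_brace
begin

abbreviation lam where "lam \<equiv> brace_lambda A C"

lemma lam_hom: "c \<in> carrier A \<Longrightarrow> lam c \<in> hom A A"
  using brace_lambda_hom by (simp add: AutoGroup_hom_iff carrier_eq)

lemma lam_group_hom: "c \<in> carrier A \<Longrightarrow> group_hom A A (lam c)"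
  using lam_hom by (intro group_hom.intro group_hom_axioms.intro) auto

lemma lam_closed [simp]: "c \<in> carrier A \<Longrightarrow> z \<in> carrier A \<Longrightarrow> lam c z \<in> carrier A"
  using lam_hom by (auto simp: hom_def)

lemma lam_one [simp]: "c \<in> carrier A \<Longrightarrow> lam c \<one>\<^bsub>A\<^esub> = \<one>\<^bsub>A\<^esub>"
  using lam_group_hom group_hom.hom_one by blast

lemma circ_closed [simp]: "a \<in> carrier A \<Longrightarrow> b \<in> carrier A \<Longrightarrow> a \<otimes>\<^bsub>C\<^esub> b \<in> carrier A"
  using circ.m_closed by (simp add: carrier_eq)

lemma circ_eq: "a \<in> carrier A \<Longrightarrow> b \<in> carrier A \<Longrightarrow> a \<otimes>\<^bsub>C\<^esub> b = a \<otimes>\<^bsub>A\<^esub> lam a b"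
  by (simp add: brace_lambda_def add.m_assoc[symmetric])

lemma one_eq: "\<one>\<^bsub>C\<^esub> = \<one>\<^bsub>A\<^esub>"
proof -
  have "\<one>\<^bsub>A\<^esub> \<otimes>\<^bsub>C\<^esub> \<one>\<^bsub>A\<^esub> = \<one>\<^bsub>A\<^esub>"
    by (simp add: circ_eq)
  then show ?thesis
    using circ.l_cancel_one' carrier_eq by (metis add.one_closed)
qed

lemma circ_one [simp]:
  assumes "a \<in> carrier A"
  shows "\<one>\<^bsub>A\<^esub> \<otimes>\<^bsub>C\<^esub> a = a" "a \<otimes>\<^bsub>C\<^esub> \<one>\<^bsub>A\<^esub> = a"
  using assms circ.l_one circ.r_one unfolding one_eq carrier_eq by blast+

lemma lam_mult:
  "c \<in> carrier A \<Longrightarrow> d \<in> carrier A \<Longrightarrow> z \<in> carrier A \<Longrightarrow> lam (c \<otimes>\<^bsub>C\<^esub> d) z = lam c (lam d z)"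
  using brace_lambda_hom by (simp add: AutoGroup_hom_iff carrier_eq compose_eq)

lemma lam_at_one [simp]: "z \<in> carrier A \<Longrightarrow> lam \<one>\<^bsub>A\<^esub> z = z"
  using circ_eq[of "\<one>\<^bsub>A\<^esub>" z] by simp

lemma lam_funpow:
  assumes "c \<in> carrier A" "z \<in> carrier A"
  shows "(lam c ^^ n) z = lam (c [^]\<^bsub>C\<^esub> n) z"
proof (induction n)
  case (Suc n)
  have "c [^]\<^bsub>C\<^esub> n \<in> carrier A"
    using assms circ.nat_pow_closed by (simp add: carrier_eq)
  then show ?case
    using assms Suc by (subst circ.nat_pow_Suc2) (simp_all add: carrier_eq lam_mult)
qed (simp add: assms one_eq)

abbreviation Lam where "Lam \<equiv> brace_Lambda A C"

lemma add_embedding: "group_hom A Lam (\<lambda>a. (a, \<one>\<^bsub>A\<^esub>))"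
  using group_brace_Lambda
  by (intro group_hom.intro group_hom_axioms.intro homI)
    (simp_all add: brace_Lambda_def carrier_eq)

lemma circ_embedding: "group_hom C Lam (\<lambda>c. (\<one>\<^bsub>A\<^esub>, c))"
  using group_brace_Lambda
  by (intro group_hom.intro group_hom_axioms.intro homI)
    (simp_all add: brace_Lambda_def carrier_eq)

text \<open>Each pair factors as \<open>(a, \<one>) (\<one>, c)\<close>, and each factor lies in the
  image of one embedding.\<close>

lemma generate_Lam:
  assumes "S \<subseteq> carrier A" "T \<subseteq> carrier A" "generate A S = carrier A" "generate C T = carrier C"
  shows "carrier Lam \<subseteq> generate Lam ((\<lambda>a. (a, \<one>\<^bsub>A\<^esub>)) ` S \<union> (\<lambda>c. (\<one>\<^bsub>A\<^esub>, c)) ` T)" (is "_ \<subseteq> ?H")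
proof clarify
  interpret L: group Lam
    by (rule group_brace_Lambda)
  fix a c assume "(a, c) \<in> carrier Lam"
  then have ac: "a \<in> carrier A" "c \<in> carrier A"
    by (simp_all add: brace_Lambda_def carrier_eq)
  have "(a, \<one>\<^bsub>A\<^esub>) \<in> (\<lambda>a. (a, \<one>\<^bsub>A\<^esub>)) ` generate A S"
    using assms(3) ac by simp
  also have "\<dots> = generate Lam ((\<lambda>a. (a, \<one>\<^bsub>A\<^esub>)) ` S)"
    using group_hom.generate_img[OF add_embedding assms(1)] by simp
  also have "\<dots> \<subseteq> ?H"
    by (rule L.mono_generate) blast
  finally have "(a, \<one>\<^bsub>A\<^esub>) \<in> ?H" .
  moreover have "(\<one>\<^bsub>A\<^esub>, c) \<in> ?H"
  proof -
    have "(\<one>\<^bsub>A\<^esub>, c) \<in> (\<lambda>c. (\<one>\<^bsub>A\<^esub>, c)) ` generate C T"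
      using assms(4) ac by (simp add: carrier_eq)
    also have "\<dots> = generate Lam ((\<lambda>c. (\<one>\<^bsub>A\<^esub>, c)) ` T)"
      using group_hom.generate_img[OF circ_embedding, of T] assms(2) by (simp add: carrier_eq)
    also have "\<dots> \<subseteq> ?H"
      by (rule L.mono_generate) blast
    finally show ?thesis .
  qed
  ultimately have "(a, \<one>\<^bsub>A\<^esub>) \<otimes>\<^bsub>Lam\<^esub> (\<one>\<^bsub>A\<^esub>, c) \<in> ?H"
    by (rule generate.eng)
  then show "(a, c) \<in> ?H"
    using ac by (simp add: brace_Lambda_def)
qed

end

locale skew_left_brace_pq = skew_left_brace A C
  for A :: "('a, 'm) monoid_scheme" and C :: "('a, 'n) monoid_scheme" +
  fixes p q :: nat
  assumes p: "Factorial_Ring.prime p" and q: "Factorial_Ring.prime q" and qp: "q < p"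
    and order: "order A = p * q"

sublocale skew_left_brace_pq \<subseteq> Apq: group_order_pq A p q
  using p q qp order by unfold_locales

sublocale skew_left_brace_pq \<subseteq> Cpq: group_order_pq C p q
  using p q qp order by unfold_locales (simp_all add: order_def carrier_eq)

context skew_left_brace_pq
begin

text \<open>The subgroup of order \<open>p\<close> of the additive group is characteristic, so it is stable under
  \<^term>\<open>lam\<close>, hence under \<open>\<circ>\<close>.\<close>

lemma circ_ord_eq:
  assumes x: "x \<in> carrier A" "add.ord x = p"
  shows "circ.ord x = p"
proof -
  define P where "P = range (\<lambda>n :: int. x [^]\<^bsub>A\<^esub> n)"
  have P: "subgroup P A" "card P = p"
    using add.subgroup_of_powers[OF x(1)] add.generate_pow_card[OF x(1)] add.generate_pow[OF x(1)] x(2)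
    by (simp_all add: P_def full_SetCompr_eq)
  have PA: "P \<subseteq> carrier A"
    using P(1) subgroup.subset by blast
  \<comment> \<open>Membership in \<open>P\<close> amounts to having trivial \<open>p\<close>-th
    power, which automorphisms preserve.\<close>
  have lamP: "lam c h \<in> P" if "c \<in> carrier A" "h \<in> P" for c h
  proof -
    have "(lam c h) [^]\<^bsub>A\<^esub> p = lam c (h [^]\<^bsub>A\<^esub> p)"
      using group_hom.hom_nat_pow[OF lam_group_hom[OF that(1)]] that PA by auto
    also have "h [^]\<^bsub>A\<^esub> p = \<one>\<^bsub>A\<^esub>"
      using add.pow_card_subgroup[OF P(1) that(2)] P(2) by simp
    finally have "(lam c h) [^]\<^bsub>A\<^esub> p = \<one>\<^bsub>A\<^esub>"
      using that by simp
    moreover have "lam c h \<in> carrier A"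
      using that PA by auto
    ultimately show ?thesis
      using Apq.powers_of_order_p[OF x, of "lam c h"] by (auto simp: P_def)
  qed
  have mult: "a \<otimes>\<^bsub>C\<^esub> b \<in> P" if "a \<in> P" "b \<in> P" for a b
  proof -
    have "a \<in> carrier A" "b \<in> carrier A"
      using that PA by auto
    then show ?thesis
      using that by (simp add: circ_eq lamP subgroup.m_closed[OF P(1)])
  qed
  have one: "\<one>\<^bsub>C\<^esub> \<in> P"
    using subgroup.one_closed[OF P(1)] one_eq by simp
  have pow: "a [^]\<^bsub>C\<^esub> (n :: nat) \<in> P" if "a \<in> P" for a n
    using that mult one by (induction n) auto
  have "subgroup P C"
  proof (rule circ.subgroupI)
    fix a assume a: "a \<in> P"
    have aC: "a \<in> carrier C"
      using a PA carrier_eq by auto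
    have "0 < p * q"
      using Apq.pos by simp
    then obtain n where n: "p * q = Suc n"
      using gr0_implies_Suc by blast
    have "a [^]\<^bsub>C\<^esub> n \<otimes>\<^bsub>C\<^esub> a = \<one>\<^bsub>C\<^esub>"
      using circ.pow_order_eq_1[OF aC] Cpq.order n by simp
    then have "inv\<^bsub>C\<^esub> a = a [^]\<^bsub>C\<^esub> n"
      using aC by (intro circ.inv_equality) auto
    then show "inv\<^bsub>C\<^esub> a \<in> P"
      using pow a by simp
  qed (use PA carrier_eq mult one in auto)
  moreover have "x \<in> P"
    using x(1) by (auto simp: P_def intro: rev_image_eqI[of "1 :: int"])
  ultimately have "x [^]\<^bsub>C\<^esub> p = \<one>\<^bsub>C\<^esub>"
    using circ.pow_card_subgroup P(2) by metis
  moreover have "x \<noteq> \<one>\<^bsub>C\<^esub>"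
    using x one_eq p add.ord_eq_1 by auto
  ultimately show ?thesis
    using x p carrier_eq by (intro circ.ord_prime_eq) auto
qed

text \<open>If the additive group is abelian, the actions of an element on the additive and on the
  multiplicative subgroup of order \<open>p\<close> coincide. This excludes the semidirect products in which an
  element of order \<open>q\<close> acts by two different nontrivial characters.\<close>

lemma exponents_eq_of_commuting:
  assumes x: "x \<in> carrier A" "add.ord x = p" and a: "a \<in> carrier A" "add.ord a = q"
    and comm: "a \<otimes>\<^bsub>A\<^esub> x = x \<otimes>\<^bsub>A\<^esub> a"
    and c: "c \<in> carrier A" "lam c x = x [^]\<^bsub>A\<^esub> (k :: int)" "c \<otimes>\<^bsub>C\<^esub> x = x [^]\<^bsub>C\<^esub> (l :: int) \<otimes>\<^bsub>C\<^esub> c"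
  shows "[k = l] (mod int p)"
proof -
  have xC: "x \<in> carrier C" "circ.ord x = p"
    using x circ_ord_eq carrier_eq by auto
  interpret f: group_hom A A "lam x"
    using lam_group_hom x by blast
  have xp: "x [^]\<^bsub>C\<^esub> p = \<one>\<^bsub>C\<^esub>"
    using circ.pow_ord_eq_1[of x] xC by simp
  have fp: "(lam x ^^ p) z = z" if "z \<in> carrier A" for z
    using lam_funpow[OF x(1) that, of p] xp one_eq that by simp
  note fixes_P = Apq.order_p_automorphism[OF lam_hom[OF x(1)] fp x]
  have lx: "lam x x = x"
    using fixes_P(1) x by blast
  obtain d :: int where d: "lam x a = x [^]\<^bsub>A\<^esub> d \<otimes>\<^bsub>A\<^esub> a"
    using fixes_P(2)[OF _ a(1)] by blast
  have aq: "a [^]\<^bsub>A\<^esub> q = \<one>\<^bsub>A\<^esub>"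
    using add.pow_ord_eq_1[of a] a by simp
  \<comment> \<open>As \<open>a\<close> and \<open>x\<close> commute, the \<open>q\<close>-th power
    of \<open>lam x a\<close> is that of \<open>x [^] d\<close>. It must be trivial, so
    \<open>p\<close> divides \<open>d\<close> and \<open>lam x\<close> fixes \<open>a\<close>, hence
    everything.\<close>
  have "a \<otimes>\<^bsub>A\<^esub> x [^]\<^bsub>A\<^esub> d = x [^]\<^bsub>A\<^esub> d \<otimes>\<^bsub>A\<^esub> a"
    using add.twist_int_pow comm x a by blast
  then have "(lam x a) [^]\<^bsub>A\<^esub> q = (x [^]\<^bsub>A\<^esub> d) [^]\<^bsub>A\<^esub> q \<otimes>\<^bsub>A\<^esub> a [^]\<^bsub>A\<^esub> q"
    using x a by (simp add: d add.pow_mult_distrib)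
  moreover have "(lam x a) [^]\<^bsub>A\<^esub> q = \<one>\<^bsub>A\<^esub>"
    using a aq by (simp flip: f.hom_nat_pow)
  moreover have "(x [^]\<^bsub>A\<^esub> d) [^]\<^bsub>A\<^esub> q = x [^]\<^bsub>A\<^esub> (d * int q)"
    using x by (subst add.int_pow_pow[symmetric]) (simp_all add: int_pow_int)
  ultimately have "x [^]\<^bsub>A\<^esub> (d * int q) = \<one>\<^bsub>A\<^esub>"
    using aq x by simp
  then have "int p dvd d * int q"
    using add.int_pow_eq_id[OF x(1)] x(2) by simp
  moreover have "coprime (int p) (int q)"
    using p q qp by (simp add: primes_coprime)
  ultimately have "int p dvd d"
    using coprime_dvd_mult_left_iff by blast
  then have "x [^]\<^bsub>A\<^esub> d = \<one>\<^bsub>A\<^esub>"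
    using add.int_pow_eq_id[OF x(1)] x(2) by simp
  then have "lam x a = a"
    using d a by simp
  then have "{z \<in> carrier A. lam x z = z} = carrier A"
    using add.subgroup_fixed_points[OF lam_hom[OF x(1)]] lx x a
    by (intro Apq.subgroup_eq_carrier[of _ x a]) auto
  then have id: "lam x z = z" if "z \<in> carrier A" for z
    using that by blast
  have "(lam x ^^ n) z = z" if "z \<in> carrier A" for z n
    using that id by (induction n) auto
  then have idn: "lam (x [^]\<^bsub>C\<^esub> n) z = z" if "z \<in> carrier A" for z and n :: nat
    using lam_funpow[OF x(1), of z n] that by simp
  have xn: "x [^]\<^bsub>C\<^esub> n \<in> carrier A" for n :: nat
    using circ.nat_pow_closed xC carrier_eq by blast
  \<comment> \<open>Because \<open>lam x\<close> is the identity, both operations agree on powers of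
    \<open>x\<close>.\<close>
  have pow: "x [^]\<^bsub>C\<^esub> n = x [^]\<^bsub>A\<^esub> n" for n :: nat
  proof (induction n)
    case (Suc n)
    then show ?case
      using circ_eq[OF xn x(1), of n] idn[OF x(1), of n] by simp
  qed (simp add: one_eq)
  define m where "m = nat (l mod int p)"
  have m: "[l = int m] (mod int p)"
    using Apq.pos by (simp add: m_def)
  have "x [^]\<^bsub>C\<^esub> l = x [^]\<^bsub>C\<^esub> m"
    using circ.int_pow_cong[OF xC(1) xp m] by (simp add: int_pow_int)
  \<comment> \<open>The product \<open>c \<circ> x\<close> is computed twice, from the conjugation
    exponent \<open>l\<close> and from the lambda exponent \<open>k\<close>; comparing the two needs
    \<open>x\<close> to be additively central.\<close>
  then have "c \<otimes>\<^bsub>C\<^esub> x = x [^]\<^bsub>A\<^esub> m \<otimes>\<^bsub>A\<^esub> c"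
    using c(3) circ_eq[OF xn c(1), of m] idn[OF c(1), of m] pow by simp
  moreover have "c \<otimes>\<^bsub>C\<^esub> x = c \<otimes>\<^bsub>A\<^esub> x [^]\<^bsub>A\<^esub> k"
    using circ_eq c x by simp
  moreover have "c \<otimes>\<^bsub>A\<^esub> x [^]\<^bsub>A\<^esub> k = x [^]\<^bsub>A\<^esub> k \<otimes>\<^bsub>A\<^esub> c"
  proof -
    let ?conj = "\<lambda>z. x \<otimes>\<^bsub>A\<^esub> z \<otimes>\<^bsub>A\<^esub> inv\<^bsub>A\<^esub> x"
    have "?conj a = a"
      using x a by (simp add: comm[symmetric] add.m_assoc)
    then have "{z \<in> carrier A. ?conj z = z} = carrier A"
      using add.subgroup_fixed_points[OF add.conjugation_hom[OF x(1)]] x a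
      by (intro Apq.subgroup_eq_carrier[of _ x a]) (auto simp: add.m_assoc)
    then have "?conj c = c"
      using c by blast
    then have "c \<otimes>\<^bsub>A\<^esub> x = x \<otimes>\<^bsub>A\<^esub> c"
      using x c by (metis add.inv_solve_right' add.m_closed)
    then show ?thesis
      using add.twist_int_pow x c by blast
  qed
  ultimately have "x [^]\<^bsub>A\<^esub> k \<otimes>\<^bsub>A\<^esub> c = x [^]\<^bsub>A\<^esub> int m \<otimes>\<^bsub>A\<^esub> c"
    by (simp add: int_pow_int)
  then have "x [^]\<^bsub>A\<^esub> k = x [^]\<^bsub>A\<^esub> int m"
    using x c by simp
  then have "[k = int m] (mod int p)"
    using add.int_pow_eq[OF x(1)] x(2) by (simp add: cong_iff_dvd_diff dvd_diff_commute)
  then show ?thesis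
    using m cong_sym cong_trans by blast
qed

lemma brace_Lambda_classification:
  assumes g: "[p = 1] (mod q) \<Longrightarrow> Pocklington.ord p g = q"
  shows "Lam \<cong> cyc2 (p * q) \<or>
    ([p = 1] (mod q) \<and>
      (Lam \<cong> semidirect (cyc2 p) (cyc2 q) (theta_act p g) \<or>
       Lam \<cong> semidirect (cyc2 p) (cyc2 q) (psi_act p g) \<or>
       Lam \<cong> semidirect (cyc2 p) (cyc2 q) (xi_act p g)))"
proof -
  interpret L: group Lam
    by (rule group_brace_Lambda)
  interpret \<iota>: group_hom A Lam "\<lambda>a. (a, \<one>\<^bsub>A\<^esub>)"
    by (rule add_embedding)
  interpret \<kappa>: group_hom C Lam "\<lambda>c. (\<one>\<^bsub>A\<^esub>, c)"
    by (rule circ_embedding)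
  obtain x where x: "x \<in> carrier A" "add.ord x = p"
    using add.cauchy_subgroup[OF add.subgroup_self Apq.finite_carrier p] order
    by (auto simp: order_def)
  have xC: "x \<in> carrier C" "circ.ord x = p"
    using x circ_ord_eq carrier_eq by auto
  obtain c where cC: "c \<in> carrier C" "circ.ord c = q"
    using circ.cauchy_subgroup[OF circ.subgroup_self Cpq.finite_carrier q] Cpq.order
    by (auto simp: order_def)
  have c: "c \<in> carrier A"
    using cC carrier_eq by simp
  have xp: "x [^]\<^bsub>C\<^esub> p = \<one>\<^bsub>C\<^esub>" and cq: "c [^]\<^bsub>C\<^esub> q = \<one>\<^bsub>C\<^esub>" and xpA: "x [^]\<^bsub>A\<^esub> p = \<one>\<^bsub>A\<^esub>"
    using circ.pow_ord_eq_1[of x] circ.pow_ord_eq_1[of c] add.pow_ord_eq_1[of x] xC cC x by simp_all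
  have "(lam c ^^ q) z = z" if "z \<in> carrier A" for z
    using lam_funpow[OF c that, of q] cq one_eq that by simp
  \<comment> \<open>Choosing \<open>a\<close> fixed by \<open>lam c\<close> is what makes
    \<open>(a, \<one>)\<close> and \<open>(\<one>, c)\<close> commute.\<close>
  then obtain a where a: "a \<in> carrier A" "add.ord a = q" "lam c a = a"
    using add.fixed_point_of_prime_order[OF lam_hom[OF c] Apq.finite_carrier q] order by auto
  have aq: "a [^]\<^bsub>A\<^esub> q = \<one>\<^bsub>A\<^esub>"
    using add.pow_ord_eq_1[of a] a by simp
  have "(lam x ^^ p) z = z" if "z \<in> carrier A" for z
    using lam_funpow[OF x(1) that, of p] xp one_eq that by simp
  note fixes_P = Apq.order_p_automorphism[OF lam_hom[OF x(1)] this x]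
  have lx: "lam x x = x"
    using fixes_P(1) x by blast
  obtain d :: int where d: "lam x a = x [^]\<^bsub>A\<^esub> d \<otimes>\<^bsub>A\<^esub> a"
    using fixes_P(2)[OF _ a(1)] by blast
  obtain i :: int where i: "a \<otimes>\<^bsub>A\<^esub> x = x [^]\<^bsub>A\<^esub> i \<otimes>\<^bsub>A\<^esub> a"
    using Apq.normalizes_order_p[OF x a(1)] .
  obtain l :: int where l: "c \<otimes>\<^bsub>C\<^esub> x = x [^]\<^bsub>C\<^esub> l \<otimes>\<^bsub>C\<^esub> c"
    using Cpq.normalizes_order_p[OF xC cC(1)] .
  have "(lam c x) [^]\<^bsub>A\<^esub> p = lam c (x [^]\<^bsub>A\<^esub> p)"
    using group_hom.hom_nat_pow[OF lam_group_hom[OF c]] x by auto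
  then obtain k :: int where k: "lam c x = x [^]\<^bsub>A\<^esub> k"
    using Apq.powers_of_order_p[OF x, of "lam c x"] x c xpA by auto
  \<comment> \<open>If \<open>i\<close> is 1 modulo \<open>p\<close>, then \<open>x\<close> and
    \<open>a\<close> commute, which is the abelian case.\<close>
  have kl: "[k = l] (mod int p)" if "[i = 1] (mod int p)"
  proof -
    have "x [^]\<^bsub>A\<^esub> i = x"
      using add.int_pow_cong[OF x(1) xpA that] x by simp
    then show ?thesis
      using i by (intro exponents_eq_of_commuting[OF x a(1,2) _ c k l]) simp
  qed
  have genA: "generate A {x, a} = carrier A"
    using x a by (intro Apq.subgroup_eq_carrier[of _ x a] add.generate_is_subgroup) (auto intro: generate.incl)
  have genC: "generate C {x, c} = carrier C"
    using xC cC by (intro Cpq.subgroup_eq_carrier[of _ x c] circ.generate_is_subgroup) (auto intro: generate.incl)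
  have mult: "(h, s) \<otimes>\<^bsub>Lam\<^esub> (h', s') = (h \<otimes>\<^bsub>A\<^esub> lam s h', s \<otimes>\<^bsub>C\<^esub> s')" for h s h' s'
    by (simp add: brace_Lambda_def)
  let ?x = "(x, \<one>\<^bsub>A\<^esub>)" and ?y = "(\<one>\<^bsub>A\<^esub>, x)" and ?u = "(a, \<one>\<^bsub>A\<^esub>)" and ?v = "(\<one>\<^bsub>A\<^esub>, c)"
  interpret P: commuting_pairs Lam p q ?x ?y ?u ?v
  proof unfold_locales
    show "1 < p" "1 < q"
      using p q prime_gt_1_nat by blast+
    show "?x \<in> carrier Lam" "?y \<in> carrier Lam" "?u \<in> carrier Lam" "?v \<in> carrier Lam"
      using x a c by (simp_all add: brace_Lambda_def carrier_eq)
    show "?x [^]\<^bsub>Lam\<^esub> p = \<one>\<^bsub>Lam\<^esub>" "?u [^]\<^bsub>Lam\<^esub> q = \<one>\<^bsub>Lam\<^esub>"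
      using x a xpA aq by (simp_all flip: \<iota>.hom_nat_pow \<iota>.hom_one)
    show "?y [^]\<^bsub>Lam\<^esub> p = \<one>\<^bsub>Lam\<^esub>" "?v [^]\<^bsub>Lam\<^esub> q = \<one>\<^bsub>Lam\<^esub>"
      using xC cC xp cq by (simp_all flip: \<kappa>.hom_nat_pow \<kappa>.hom_one)
    show "?x \<otimes>\<^bsub>Lam\<^esub> ?y = ?y \<otimes>\<^bsub>Lam\<^esub> ?x" "?u \<otimes>\<^bsub>Lam\<^esub> ?v = ?v \<otimes>\<^bsub>Lam\<^esub> ?u"
      using x a c lx by (simp_all add: mult)
    have "insert ?x (insert ?y {?u, ?v}) =
        (\<lambda>a. (a, \<one>\<^bsub>A\<^esub>)) ` {x, a} \<union> (\<lambda>c. (\<one>\<^bsub>A\<^esub>, c)) ` {x, c}"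
      by auto
    then show "carrier Lam \<subseteq> generate Lam {?x, ?y, ?u, ?v}"
      using generate_Lam[OF _ _ genA genC] x a c by simp
    show "order Lam = (p * q)\<^sup>2"
      using order by (simp add: brace_Lambda_def order_def carrier_eq power2_eq_square card_cartesian_product)
  qed
  have x_pow: "?x [^]\<^bsub>Lam\<^esub> n = (x [^]\<^bsub>A\<^esub> n, \<one>\<^bsub>A\<^esub>)" for n :: int
    using \<iota>.hom_int_pow[OF x(1)] by simp
  have y_pow: "?y [^]\<^bsub>Lam\<^esub> n = (\<one>\<^bsub>A\<^esub>, x [^]\<^bsub>C\<^esub> n)" for n :: int
    using \<kappa>.hom_int_pow[OF xC(1)] by simp
  have xn: "x [^]\<^bsub>C\<^esub> (n :: int) \<in> carrier A" for n
    using circ.int_pow_closed[OF xC(1)] carrier_eq by simp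
  have ux: "?u \<otimes>\<^bsub>Lam\<^esub> ?x = ?x [^]\<^bsub>Lam\<^esub> i \<otimes>\<^bsub>Lam\<^esub> ?u"
    unfolding x_pow mult using x a i by simp
  have vx: "?v \<otimes>\<^bsub>Lam\<^esub> ?x = ?x [^]\<^bsub>Lam\<^esub> k \<otimes>\<^bsub>Lam\<^esub> ?v"
    unfolding x_pow mult using x c k by simp
  have vy: "?v \<otimes>\<^bsub>Lam\<^esub> ?y = ?y [^]\<^bsub>Lam\<^esub> l \<otimes>\<^bsub>Lam\<^esub> ?v"
    unfolding y_pow mult using x c l xn by simp
  \<comment> \<open>Here \<open>(\<one>, x) (a, \<one>)\<close> has first component
    \<open>lam x a\<close>, that is \<open>x [^] d\<close> times \<open>a\<close>; the factor with
    exponent \<open>- d\<close> cancels this shift.\<close>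
  have uy: "?u \<otimes>\<^bsub>Lam\<^esub> ?y = ?x [^]\<^bsub>Lam\<^esub> (- d) \<otimes>\<^bsub>Lam\<^esub> ?y \<otimes>\<^bsub>Lam\<^esub> ?u"
  proof -
    have "x [^]\<^bsub>A\<^esub> (- d) \<otimes>\<^bsub>A\<^esub> lam x a = a"
      using x a by (simp add: d add.int_pow_neg add.m_assoc[symmetric])
    then show ?thesis
      unfolding x_pow mult using x a by simp
  qed
  have "x \<noteq> \<one>\<^bsub>A\<^esub>"
    using add.ord_eq_1[OF x(1)] x(2) prime_gt_1_nat[OF p] by simp
  then have "?x \<noteq> \<one>\<^bsub>Lam\<^esub>" "?y \<noteq> \<one>\<^bsub>Lam\<^esub>"
    by (simp_all flip: \<iota>.hom_one)
  then show ?thesis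
    by (rule P.iso_triangular[OF p q qp _ _ ux uy vx vy kl g])
qed

end

theorem theorem3p10:
  fixes p q g :: nat
    and A :: "('a, 'm) monoid_scheme" and C :: "('a, 'n) monoid_scheme"
  assumes "Factorial_Ring.prime p" and "Factorial_Ring.prime q" and "q < p"
    and "skew_left_brace A C" and "order A = p * q"
    and "[p = 1] (mod q) \<Longrightarrow> g < p \<and> ord p g = q"
  shows "brace_Lambda A C \<cong> integer_mod_group (p * q) \<times>\<times> integer_mod_group (p * q) \<or>
    ([p = 1] (mod q) \<and>
      (brace_Lambda A C \<cong> semidirect (cyc2 p) (cyc2 q) (theta_act p g) \<or>
       brace_Lambda A C \<cong> semidirect (cyc2 p) (cyc2 q) (psi_act p g) \<or>
       brace_Lambda A C \<cong> semidirect (cyc2 p) (cyc2 q) (xi_act p g)))"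
proof -
  interpret skew_left_brace A C
    by fact
  interpret skew_left_brace_pq A C p q
    using assms by unfold_locales
  show ?thesis
    using assms(6) by (intro brace_Lambda_classification) blast
qed

end
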